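(* Let $d\in\mathbb{N}$, let $P$ be a stationary and ergodic probability measure on $\Omega=[0,1]^{\mathcal{K}^d}$, and fix an integer $0\le q<d$. For each $t\in[0,1]$ let $\widehat\beta_q(t)$ be the non-random constant such that $|\Lambda_n|^{-1}\beta_q^n(t)\to\widehat\beta_q(t)$ almost surely (such a constant exists for every $t$). Assume that for every $Q\in\mathcal{K}^d$ the marginal distribution function $F^Q(t)=P(\omega_Q\le t)$ is continuous in $t\in[0,1]$. Then $$\lim_{n\to\infty}\sup_{t\in[0,1]}\Big|\frac{1}{|\Lambda_n|}\beta_q^n(t)-\widehat\beta_q(t)\Big|=0\quad\text{almost surely.}$$
   Context: An elementary interval is a closed interval $[l,l+1]$ or a degenerate interval $[l]=[l,l]$ with $l\in\mathbb{Z}$. An elementary cube in $\mathbb{R}^d$ is a product $Q=I_1\times\cdots\times I_d$ of elementary intervals; its dimension is the number of nondegenerate factors. $\mathcal{K}^d$ denotes the set of all elementary cubes in $\mathbb{R}^d$. A cubical set is a (possibly infinite) union of elementary cubes. For a cubical set $X$, the cubical chain complex has $C_k(X)$ the free $\mathbb{Z}$-module generated by the $k$-dimensional elementary cubes contained in $X$, with the standard cubical boundary operator; $H_k(X)$ is its homology, and for bounded $X$, $\beta_k(X)$ is the rank of the free part of $H_k(X)$. Random model: $\Omega=[0,1]^{\mathcal{K}^d}$ with product topology and Borel $\sigma$-field; $\omega=(\omega_Q)_{Q\in\mathcal{K}^d}$. Translations $\tau_x\omega=(\omega_{-x+Q})_Q$, $x\in\mathbb{Z}^d$; stationarity means $P\circ\tau_x^{-1}=P$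 for all $x$, ergodicity means translation-invariant events have probability $0$ or $1$. For $t\in[0,1]$, $X(t)=\bigcup\{Q\in\mathcal{K}^d:\omega_Q\le t\}$, $\Lambda_n=[-n,n]^d$, $X^n(t)=X(t)\cap\Lambda_n$, $\beta_q^n(t)=\beta_q(X^n(t))$, $|\Lambda_n|=(2n)^d$ its Lebesgue measure. *)

theory Defs
  imports "HOL-Probability.Probability"
begin

text \<open>An elementary interval is encoded as a pair (l, b): b = True means the
nondegenerate interval [l, l+1], b = False the degenerate interval [l].
An elementary cube in R^d is a list of d elementary intervals; points of R^d
are real lists of length d.\<close>

type_synonym eint = "int \<times> bool"
type_synonym ecube = "eint list"

definition eint_set :: "eint \<Rightarrow> real set" where
  "eint_set I = (if snd I then {real_of_int (fst I) .. real_of_int (fst I) + 1}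
                 else {real_of_int (fst I)})"

definition elem_cubes :: "nat \<Rightarrow> ecube set" where
  "elem_cubes d = {Q. length Q = d}"

definition cube_set :: "ecube \<Rightarrow> real list set" where
  "cube_set Q = {x. length x = length Q \<and> (\<forall>i<length Q. x ! i \<in> eint_set (Q ! i))}"

definition cube_dim :: "ecube \<Rightarrow> nat" where
  "cube_dim Q = length (filter snd Q)"

definition cubes_in :: "nat \<Rightarrow> real list set \<Rightarrow> nat \<Rightarrow> ecube set" where
  "cubes_in d X k = {Q \<in> elem_cubes d. cube_dim Q = k \<and> cube_set Q \<subseteq> X}"

text \<open>Coefficient of P in the standard cubical boundary of Q:
 boundary (I_1 x ... x I_d) = sum over nondegenerate I_j = [l,l+1] of
 (-1)^(number of nondegenerate factors before j) ( Q[I_j := [l+1]] - Q[I_j := [l]] ).\<close>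
definition incidence :: "ecube \<Rightarrow> ecube \<Rightarrow> int" where
  "incidence Q P = (\<Sum>j<length Q.
      if snd (Q ! j) then
        (-1) ^ length (filter snd (take j Q)) *
        ((if P = Q[j := (fst (Q ! j) + 1, False)] then 1 else 0)
         - (if P = Q[j := (fst (Q ! j), False)] then 1 else 0))
      else 0)"

type_synonym chain = "ecube \<Rightarrow> int"

definition chains :: "nat \<Rightarrow> real list set \<Rightarrow> nat \<Rightarrow> chain set" where
  "chains d X k = {c. finite {Q. c Q \<noteq> 0} \<and> (\<forall>Q. c Q \<noteq> 0 \<longrightarrow> Q \<in> cubes_in d X k)}"

definition bdry :: "chain \<Rightarrow> chain" where
  "bdry c = (\<lambda>P. \<Sum>Q\<in>{Q. c Q \<noteq> 0}. c Q * incidence Q P)"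

definition cycles :: "nat \<Rightarrow> real list set \<Rightarrow> nat \<Rightarrow> chain set" where
  "cycles d X k = {c \<in> chains d X k. bdry c = (\<lambda>_. 0)}"

definition boundaries :: "nat \<Rightarrow> real list set \<Rightarrow> nat \<Rightarrow> chain set" where
  "boundaries d X k = bdry ` chains d X (Suc k)"

text \<open>Betti number: rank of the abelian group H_k = Z_k / B_k, i.e. the maximal
number of cycles that are Z-linearly independent modulo boundaries
(= rank of the free part of H_k for bounded X).\<close>
definition betti :: "nat \<Rightarrow> real list set \<Rightarrow> nat \<Rightarrow> nat" where
  "betti d X k = (GREATEST m. \<exists>zs. length zs = m \<and> set zs \<subseteq> cycles d X k \<and>
     (\<forall>a :: nat \<Rightarrow> int. (\<lambda>Q. \<Sum>i<m. a i * (zs ! i) Q) \<in> boundaries d X k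
        \<longrightarrow> (\<forall>i<m. a i = 0)))"

definition Omega :: "nat \<Rightarrow> (ecube \<Rightarrow> real) measure" where
  "Omega d = PiM (elem_cubes d) (\<lambda>_. restrict_space borel {0..1::real})"

definition shift_cube :: "int list \<Rightarrow> ecube \<Rightarrow> ecube" where
  "shift_cube x Q = map (\<lambda>(I, v). (fst I + v, snd I)) (zip Q x)"

definition tau :: "nat \<Rightarrow> int list \<Rightarrow> (ecube \<Rightarrow> real) \<Rightarrow> (ecube \<Rightarrow> real)" where
  "tau d x \<omega> = (\<lambda>Q. if Q \<in> elem_cubes d then \<omega> (shift_cube (map uminus x) Q) else undefined)"

definition stationary :: "nat \<Rightarrow> (ecube \<Rightarrow> real) measure \<Rightarrow> bool" where
  "stationary d P \<longleftrightarrow> (\<forall>x. length x = d \<longrightarrow>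
      (\<forall>A\<in>sets P. emeasure P (tau d x -` A \<inter> space P) = emeasure P A))"

definition ergodic :: "nat \<Rightarrow> (ecube \<Rightarrow> real) measure \<Rightarrow> bool" where
  "ergodic d P \<longleftrightarrow> (\<forall>A\<in>sets P. (\<forall>x. length x = d \<longrightarrow> tau d x -` A \<inter> space P = A)
      \<longrightarrow> measure P A = 0 \<or> measure P A = 1)"

definition Xt :: "nat \<Rightarrow> (ecube \<Rightarrow> real) \<Rightarrow> real \<Rightarrow> real list set" where
  "Xt d \<omega> t = \<Union> {cube_set Q | Q. Q \<in> elem_cubes d \<and> \<omega> Q \<le> t}"

definition Lambda :: "nat \<Rightarrow> nat \<Rightarrow> real list set" where
  "Lambda d n = {x. length x = d \<and> (\<forall>i<d. \<bar>x ! i\<bar> \<le> real n)}"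

definition Xn :: "nat \<Rightarrow> (ecube \<Rightarrow> real) \<Rightarrow> nat \<Rightarrow> real \<Rightarrow> real list set" where
  "Xn d \<omega> n t = Xt d \<omega> t \<inter> Lambda d n"

definition betti_n :: "nat \<Rightarrow> nat \<Rightarrow> (ecube \<Rightarrow> real) \<Rightarrow> nat \<Rightarrow> real \<Rightarrow> real" where
  "betti_n d q \<omega> n t = real (betti d (Xn d \<omega> n t) q)"

definition vol_Lambda :: "nat \<Rightarrow> nat \<Rightarrow> real" where
  "vol_Lambda d n = (2 * real n) ^ d"

end

theory Submission
  imports Defs "HOL-Real_Asymp.Real_Asymp"
begin

text \<open>Adding cubes to a finite cubical complex changes a Betti number by at most the number of
cubes added, so for \<open>s \<le> t\<close> the difference of the Betti numbers at levels \<open>s\<close> and \<open>t\<close> is bounded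
by a constant times the number of cubes \<open>R\<close> near the window with \<open>s < \<omega> R \<le> t\<close>. This count is
an ergodic sum. A Vitali covering argument gives a weak-type maximal inequality for such sums; since
their upper limit is invariant under translations, ergodicity turns the inequality into the almost
sure bound \<open>limsup \<le> 2^d E\<close>, a constant factor short of the ergodic theorem but sufficient here. As
the marginal distribution functions are uniformly continuous, a fine partition of \<open>[0,1]\<close> makes
all these bounds small simultaneously, and uniform convergence follows from convergence at the
finitely many partition points.\<close>

section \<open>Betti numbers under the addition of cubes\<close>

text \<open>\<open>Z\<close> and \<open>B\<close> are the cycles and boundaries of two sets of cubes that need not form a chain complex,
so that cubes of dimension \<open>k\<close> and \<open>k + 1\<close> can be added one at a time.\<close>
definition indep_mod :: "('a \<Rightarrow> int) set \<Rightarrow> ('a \<Rightarrow> int) set \<Rightarrow> nat \<Rightarrow> bool" where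
  "indep_mod Z B m \<longleftrightarrow> (\<exists>(I :: nat set) z. finite I \<and> card I = m \<and> (\<forall>i\<in>I. z i \<in> Z) \<and>
     (\<forall>a. (\<lambda>Q. \<Sum>i\<in>I. a i * z i Q) \<in> B \<longrightarrow> (\<forall>i\<in>I. a i = 0)))"

lemma indep_modI:
  fixes I :: "nat set"
  assumes "finite I" "card I = m" "\<And>i. i \<in> I \<Longrightarrow> z i \<in> Z"
    "\<And>a i. (\<lambda>Q. \<Sum>i\<in>I. a i * z i Q) \<in> B \<Longrightarrow> i \<in> I \<Longrightarrow> a i = 0"
  shows "indep_mod Z B m"
proof -
  have "\<forall>i\<in>I. z i \<in> Z" using assms(3) by simp
  moreover have "\<forall>a::nat \<Rightarrow> int. (\<lambda>Q. \<Sum>i\<in>I. a i * z i Q) \<in> B \<longrightarrow> (\<forall>i\<in>I. a i = 0)"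
    by (intro allI impI ballI) (rule assms(4))
  ultimately show ?thesis
    unfolding indep_mod_def using assms(1,2)
    by (intro exI[of _ I] exI[of _ z] conjI) assumption+
qed

lemma indep_modE:
  assumes "indep_mod Z B m"
  obtains I :: "nat set" and z where "finite I" "card I = m" "\<And>i. i \<in> I \<Longrightarrow> z i \<in> Z"
    "\<And>a i. (\<lambda>Q. \<Sum>i\<in>I. a i * z i Q) \<in> B \<Longrightarrow> i \<in> I \<Longrightarrow> a i = 0"
  using assms unfolding indep_mod_def by (elim exE conjE) (rule that, auto)

lemma indep_mod_0: "indep_mod Z B 0"
  by (rule indep_modI[of "{}"]) simp_all

lemma indep_mod_mono:
  assumes "indep_mod Z B m" "Z \<subseteq> Z'" "B' \<subseteq> B"
  shows "indep_mod Z' B' m"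
proof -
  obtain I :: "nat set" and z where I: "finite I" "card I = m" "\<And>i. i \<in> I \<Longrightarrow> z i \<in> Z"
    "\<And>a i. (\<lambda>Q. \<Sum>i\<in>I. a i * z i Q) \<in> B \<Longrightarrow> i \<in> I \<Longrightarrow> a i = 0"
    using assms(1) by (rule indep_modE) (rule that, auto)
  show ?thesis
    by (rule indep_modI[OF I(1,2), of z])
      (use I(3) assms(2) in blast, rule I(4)[OF subsetD[OF assms(3)]])
qed

lemma indep_mod_le:
  assumes "indep_mod Z B m" "k \<le> m" 
  shows "indep_mod Z B k"
proof -
  obtain I :: "nat set" and z where I: "finite I" "card I = m" "\<And>i. i \<in> I \<Longrightarrow> z i \<in> Z"
    "\<And>a i. (\<lambda>Q. \<Sum>i\<in>I. a i * z i Q) \<in> B \<Longrightarrow> i \<in> I \<Longrightarrow> a i = 0"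
    using assms(1) by (rule indep_modE) (rule that, auto)
  obtain J where J: "J \<subseteq> I" "card J = k" "finite J"
    using obtain_subset_with_card_n I(2) assms(2) by metis
  show ?thesis
  proof (rule indep_modI[of J _ z])
    fix a i assume a: "(\<lambda>Q. \<Sum>i\<in>J. a i * z i Q) \<in> B" and i: "i \<in> J"
    have "(\<Sum>i\<in>I. (if i \<in> J then a i else 0) * z i Q) = (\<Sum>i\<in>J. a i * z i Q)" for Q
      using J(1) I(1) by (intro sum.mono_neutral_cong_right) auto
    with a have "(\<lambda>Q. \<Sum>i\<in>I. (if i \<in> J then a i else 0) * z i Q) \<in> B" by simp
    from I(4)[OF this, of i] i J(1) show "a i = 0" by auto
  qed (use I J in auto)
qed

text \<open>Integral elimination at \<open>R\<close>: with a pivot \<open>z j\<close> that is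
  nonzero at \<open>R\<close>, every other member \<open>z i\<close> is replaced by
  \<open>z j R * z i - z i R * z j\<close>, which vanishes at \<open>R\<close>. Only the pivot is
  lost.\<close>

lemma indep_mod_vanishing:
  assumes ind: "indep_mod Z B (Suc m)"
    and comb: "\<And>u v k l. u \<in> Z \<Longrightarrow> v \<in> Z \<Longrightarrow> (\<lambda>Q. k * u Q - l * v Q) \<in> Z"
  shows "indep_mod {c \<in> Z. c R = 0} B m"
proof -
  obtain I :: "nat set" and z where I: "finite I" "card I = Suc m" "\<And>i. i \<in> I \<Longrightarrow> z i \<in> Z"
    "\<And>a i. (\<lambda>Q. \<Sum>i\<in>I. a i * z i Q) \<in> B \<Longrightarrow> i \<in> I \<Longrightarrow> a i = 0"
    using ind by (rule indep_modE) (rule that, auto)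
  show ?thesis
  proof (cases "\<forall>i\<in>I. z i R = 0")
    case True
    then have "indep_mod {c \<in> Z. c R = 0} B (Suc m)"
      using I(3) by (intro indep_modI[OF I(1,2), of z]) (auto intro: I(4))
    then show ?thesis by (rule indep_mod_le) simp
  next
    case False
    then obtain j where j: "j \<in> I" "z j R \<noteq> 0" by blast
    define w where "w i = (\<lambda>Q. z j R * z i Q - z i R * z j Q)" for i
    show ?thesis
    proof (rule indep_modI[of "I - {j}" _ w])
      fix i assume "i \<in> I - {j}"
      then show "w i \<in> {c \<in> Z. c R = 0}"
        using comb[of "z i" "z j"] I(3) j by (auto simp: w_def)
    next
      fix a i assume a: "(\<lambda>Q. \<Sum>i\<in>I - {j}. a i * w i Q) \<in> B" and i: "i \<in> I - {j}"
      \<comment> \<open>The coefficients of the same chain in terms of the \<open>z i\<close>; away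
        from the pivot they are \<open>a i * z j R\<close>, which vanishes only if
        \<open>a i\<close> does.\<close>
      define b where "b i = (if i = j then - (\<Sum>i\<in>I - {j}. a i * z i R) else a i * z j R)" for i
      have "(\<Sum>i\<in>I. b i * z i Q) = (\<Sum>i\<in>I - {j}. a i * w i Q)" for Q
      proof -
        have "(\<Sum>i\<in>I. b i * z i Q) = b j * z j Q + (\<Sum>i\<in>I - {j}. b i * z i Q)"
          using I(1) j(1) by (rule sum.remove)
        also have "(\<Sum>i\<in>I - {j}. b i * z i Q) = (\<Sum>i\<in>I - {j}. a i * z j R * z i Q)"
          by (rule sum.cong) (auto simp: b_def)
        also have "b j * z j Q = - (\<Sum>i\<in>I - {j}. a i * z i R * z j Q)"
          by (simp add: b_def sum_distrib_right)
        finally show ?thesis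
          by (simp add: w_def algebra_simps sum_subtractf)
      qed
      with a have "(\<lambda>Q. \<Sum>i\<in>I. b i * z i Q) \<in> B" by simp
      from I(4)[OF this, of i] i j(2) show "a i = 0" by (auto simp: b_def)
    qed (use I j in auto)
  qed
qed

text \<open>If the family becomes dependent, a relation with \<open>a j \<noteq> 0\<close> singles
  out a member \<open>z j\<close> to drop. Any relation among the remaining members can be combined
  with that one so that \<open>b\<close> cancels, and independence modulo \<open>B\<close> applies
  again.\<close>

lemma indep_mod_add_relation:
  assumes ind: "indep_mod Z B (Suc m)"
    and comb: "\<And>u v k l. u \<in> B \<Longrightarrow> v \<in> B \<Longrightarrow> (\<lambda>Q. k * u Q - l * v Q) \<in> B"
  shows "indep_mod Z {(\<lambda>Q. u Q + k * b Q) | u k. u \<in> B} m"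
proof -
  let ?B = "{(\<lambda>Q. u Q + k * b Q) | u k. u \<in> B}"
  obtain I :: "nat set" and z where I: "finite I" "card I = Suc m" "\<And>i. i \<in> I \<Longrightarrow> z i \<in> Z"
    "\<And>a i. (\<lambda>Q. \<Sum>i\<in>I. a i * z i Q) \<in> B \<Longrightarrow> i \<in> I \<Longrightarrow> a i = 0"
    using ind by (rule indep_modE) (rule that, auto)
  show ?thesis
  proof (cases "\<forall>a. (\<lambda>Q. \<Sum>i\<in>I. a i * z i Q) \<in> ?B \<longrightarrow> (\<forall>i\<in>I. a i = 0)")
    case True
    moreover have "\<forall>i\<in>I. z i \<in> Z" using I(3) by simp
    ultimately have "indep_mod Z ?B (Suc m)"
      unfolding indep_mod_def using I(1,2) by (intro exI[of _ I] exI[of _ z] conjI) assumption+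
    then show ?thesis by (rule indep_mod_le) simp
  next
    case False
    then obtain a j where a: "(\<lambda>Q. \<Sum>i\<in>I. a i * z i Q) \<in> ?B" and j: "j \<in> I" "a j \<noteq> 0" by blast
    from a obtain u k where u: "u \<in> B" and eq: "(\<lambda>Q. \<Sum>i\<in>I. a i * z i Q) = (\<lambda>Q. u Q + k * b Q)"
      by blast
    have k: "k \<noteq> 0"
    proof
      assume "k = 0"
      then have "(\<lambda>Q. \<Sum>i\<in>I. a i * z i Q) \<in> B" using eq u by simp
      from I(4)[OF this j(1)] show False using j(2) by simp
    qed
    show ?thesis
    proof (rule indep_modI[of "I - {j}" _ z])
      fix c i assume c: "(\<lambda>Q. \<Sum>i\<in>I - {j}. c i * z i Q) \<in> ?B" and i: "i \<in> I - {j}"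
      from c obtain v l where v: "v \<in> B" and
        eq2: "(\<lambda>Q. \<Sum>i\<in>I - {j}. c i * z i Q) = (\<lambda>Q. v Q + l * b Q)"
        by blast
      define c' where "c' i = (if i = j then 0 else c i)" for i
      have c': "(\<Sum>i\<in>I. c' i * z i Q) = v Q + l * b Q" for Q
      proof -
        have "(\<Sum>i\<in>I. c' i * z i Q) = c' j * z j Q + (\<Sum>i\<in>I - {j}. c' i * z i Q)"
          using I(1) j(1) by (rule sum.remove)
        also have "(\<Sum>i\<in>I - {j}. c' i * z i Q) = (\<Sum>i\<in>I - {j}. c i * z i Q)"
          by (rule sum.cong) (auto simp: c'_def)
        finally show ?thesis using fun_cong[OF eq2, of Q] by (simp add: c'_def)
      qed
      \<comment> \<open>Cross-multiplication eliminates \<open>b\<close>: \<open>k\<close> times the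
        second relation minus \<open>l\<close> times the first.\<close>
      have "(\<Sum>i\<in>I. (k * c' i - l * a i) * z i Q) = k * v Q - l * u Q" for Q
      proof -
        have "(\<Sum>i\<in>I. (k * c' i - l * a i) * z i Q)
          = k * (\<Sum>i\<in>I. c' i * z i Q) - l * (\<Sum>i\<in>I. a i * z i Q)"
          by (simp add: sum_distrib_left sum_subtractf algebra_simps)
        then show ?thesis using c'[of Q] fun_cong[OF eq, of Q] by (simp add: algebra_simps)
      qed
      then have "(\<lambda>Q. \<Sum>i\<in>I. (k * c' i - l * a i) * z i Q) \<in> B"
        using comb[OF v u, of k l] by simp
      from I(4)[OF this] have *: "k * c' i - l * a i = 0" if "i \<in> I" for i
        using that .
      \<comment> \<open>Since \<open>c' j = 0\<close>, the coefficient at \<open>j\<close> is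
        \<open>- l * a j\<close>; hence \<open>l = 0\<close>, and \<open>k \<noteq> 0\<close>
        settles the other indices.\<close>
      have "l = 0" using *[OF j(1)] j(2) by (simp add: c'_def)
      then show "c i = 0" using *[of i] i k by (auto simp: c'_def)
    qed (use I j in auto)
  qed
qed

section \<open>Cycles and boundaries of finite sets of cubes\<close>

definition cyc :: "ecube set \<Rightarrow> chain set" where
  "cyc A = {c. (\<forall>Q. c Q \<noteq> 0 \<longrightarrow> Q \<in> A) \<and> bdry c = (\<lambda>_. 0)}"

definition bnd :: "ecube set \<Rightarrow> chain set" where
  "bnd C = bdry ` {c. \<forall>Q. c Q \<noteq> 0 \<longrightarrow> Q \<in> C}"

lemma bdry_superset:
  assumes "finite S" "\<And>Q. c Q \<noteq> 0 \<Longrightarrow> Q \<in> S"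
  shows "bdry c = (\<lambda>P. \<Sum>Q\<in>S. c Q * incidence Q P)"
  unfolding bdry_def using assms by (intro ext sum.mono_neutral_left) auto

lemma comb_nonzero:
  fixes k l u v :: int
  shows "k * u - l * v \<noteq> 0 \<Longrightarrow> u \<noteq> 0 \<or> v \<noteq> 0"
  by auto

lemma bdry_comb:
  assumes S: "finite S" "\<And>Q. c Q \<noteq> 0 \<Longrightarrow> Q \<in> S" "\<And>Q. c' Q \<noteq> 0 \<Longrightarrow> Q \<in> S"
  shows "bdry (\<lambda>Q. k * c Q - l * c' Q) = (\<lambda>P. k * bdry c P - l * bdry c' P)"
proof -
  have "bdry (\<lambda>Q. k * c Q - l * c' Q) = (\<lambda>P. \<Sum>Q\<in>S. (k * c Q - l * c' Q) * incidence Q P)"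
    by (rule bdry_superset) (use S comb_nonzero in blast)+
  moreover have "bdry c = (\<lambda>P. \<Sum>Q\<in>S. c Q * incidence Q P)"
    by (rule bdry_superset) (use S in blast)+
  moreover have "bdry c' = (\<lambda>P. \<Sum>Q\<in>S. c' Q * incidence Q P)"
    by (rule bdry_superset) (use S in blast)+
  ultimately show ?thesis
    by (simp add: sum_distrib_left sum_subtractf algebra_simps)
qed

lemma cyc_comb:
  assumes "finite A" "u \<in> cyc A" "v \<in> cyc A"
  shows "(\<lambda>Q. k * u Q - l * v Q) \<in> cyc A"
proof -
  have uv: "\<And>Q. u Q \<noteq> 0 \<Longrightarrow> Q \<in> A" "\<And>Q. v Q \<noteq> 0 \<Longrightarrow> Q \<in> A" "bdry u = (\<lambda>_. 0)" "bdry v = (\<lambda>_. 0)"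
    using assms unfolding cyc_def by blast+
  have "bdry (\<lambda>Q. k * u Q - l * v Q) = (\<lambda>_. 0)"
    using bdry_comb[of A u v k l] assms(1) uv by simp
  then show ?thesis unfolding cyc_def using uv(1,2) comb_nonzero by blast
qed

lemma bnd_comb:
  assumes "finite C" "u \<in> bnd C" "v \<in> bnd C"
  shows "(\<lambda>Q. k * u Q - l * v Q) \<in> bnd C"
proof -
  obtain c c' where c: "\<forall>Q. c Q \<noteq> 0 \<longrightarrow> Q \<in> C" "\<forall>Q. c' Q \<noteq> 0 \<longrightarrow> Q \<in> C" "u = bdry c" "v = bdry c'"
    using assms unfolding bnd_def by blast
  have "(\<lambda>Q. k * u Q - l * v Q) = bdry (\<lambda>Q. k * c Q - l * c' Q)"
    using bdry_comb[of C c c' k l] assms(1) c by simp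
  moreover have "\<forall>Q. k * c Q - l * c' Q \<noteq> 0 \<longrightarrow> Q \<in> C"
    using c(1,2) comb_nonzero by blast
  ultimately show ?thesis unfolding bnd_def by blast
qed

lemma cyc_insert: "{c \<in> cyc (insert R A). c R = 0} \<subseteq> cyc A"
  unfolding cyc_def by auto

text \<open>The term split off at \<open>R\<close> is a multiple of \<open>incidence R\<close>, the
  boundary of the single cube \<open>R\<close>. One more cube thus contributes one more relation, of
  the form treated in \<open>indep_mod_add_relation\<close>.\<close>

lemma bnd_insert:
  assumes "finite C" "R \<notin> C"
  shows "bnd (insert R C) \<subseteq> {(\<lambda>Q. u Q + k * incidence R Q) | u k. u \<in> bnd C}"
proof
  fix w assume "w \<in> bnd (insert R C)"
  then obtain c where c: "\<forall>Q. c Q \<noteq> 0 \<longrightarrow> Q \<in> insert R C" "w = bdry c" unfolding bnd_def by blast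
  have w: "w = (\<lambda>P. \<Sum>Q\<in>insert R C. c Q * incidence Q P)"
    unfolding c(2) by (rule bdry_superset) (use assms c in auto)
  have "bdry (c(R := 0)) = (\<lambda>P. \<Sum>Q\<in>C. (c(R := 0)) Q * incidence Q P)"
    by (rule bdry_superset) (use assms c in \<open>auto split: if_splits\<close>)
  also have "\<dots> = (\<lambda>P. \<Sum>Q\<in>C. c Q * incidence Q P)"
    using assms by (intro ext sum.cong) auto
  finally have "w = (\<lambda>P. bdry (c(R := 0)) P + c R * incidence R P)"
    unfolding w using assms by (auto simp: sum.insert)
  moreover have "bdry (c(R := 0)) \<in> bnd C"
    unfolding bnd_def using c by (intro imageI) auto
  ultimately show "w \<in> {(\<lambda>Q. u Q + k * incidence R Q) | u k. u \<in> bnd C}" by blast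
qed

lemma bnd_mono: "C \<subseteq> C' \<Longrightarrow> bnd C \<subseteq> bnd C'"
  unfolding bnd_def by (intro image_mono) auto

lemma cyc_mono: "C \<subseteq> C' \<Longrightarrow> cyc C \<subseteq> cyc C'"
  unfolding cyc_def by auto

text \<open>A cycle that vanishes at the deleted cube is a cycle of the remaining cubes, and by
  \<open>indep_mod_vanishing\<close> forcing one coordinate to vanish costs at most one
  member.\<close>

lemma indep_mod_cyc_remove:
  assumes "finite D" "finite A" "indep_mod (cyc (A \<union> D)) B m"
  shows "indep_mod (cyc A) B (m - card D)"
  using assms(1,3)
proof (induction D arbitrary: m rule: finite_induct)
  case (insert R D)
  have "indep_mod (cyc (A \<union> D)) B (m - 1)"
  proof (cases m)
    case 0
    then show ?thesis by (simp add: indep_mod_0)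
  next
    case (Suc k)
    have "indep_mod {c \<in> cyc (insert R (A \<union> D)). c R = 0} B k"
      by (rule indep_mod_vanishing)
        (use insert.prems Suc insert.hyps(1) assms(2) cyc_comb[of "insert R (A \<union> D)"] in simp_all)
    then show ?thesis using indep_mod_mono[OF _ cyc_insert subset_refl] Suc by simp
  qed
  then have "indep_mod (cyc A) B (m - 1 - card D)" by (rule insert.IH)
  then show ?case using insert.hyps by simp
qed simp

text \<open>The counterpart one dimension higher: each added cube brings in one relation, which
  costs at most one member. Truncated subtraction makes the claim trivial once nothing is
  left.\<close>

lemma indep_mod_bnd_add:
  assumes "finite D" "finite C" "C \<inter> D = {}" "indep_mod Z (bnd C) m"
  shows "indep_mod Z (bnd (C \<union> D)) (m - card D)"
  using assms(1,3)
proof (induction D rule: finite_induct)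
  case (insert R D)
  then have IH: "indep_mod Z (bnd (C \<union> D)) (m - card D)" by simp
  have "indep_mod Z (bnd (insert R (C \<union> D))) (m - card D - 1)"
  proof (cases "m - card D")
    case 0
    then show ?thesis by (simp add: indep_mod_0)
  next
    case (Suc k)
    have "indep_mod Z {(\<lambda>Q. u Q + k * incidence R Q) | u k. u \<in> bnd (C \<union> D)} k"
    proof (rule indep_mod_add_relation)
      show "indep_mod Z (bnd (C \<union> D)) (Suc k)" using IH Suc by simp
      show "(\<lambda>Q. k * u Q - l * v Q) \<in> bnd (C \<union> D)"
        if "u \<in> bnd (C \<union> D)" "v \<in> bnd (C \<union> D)" for u v k l
        using that insert.hyps(1) assms(2) by (intro bnd_comb) auto
    qed
    then have "indep_mod Z (bnd (insert R (C \<union> D))) k"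
      by (rule indep_mod_mono[OF _ subset_refl bnd_insert])
        (use insert.hyps insert.prems assms(2) in auto)
    then show ?thesis
      using Suc by simp
  qed
  then show ?case using insert.hyps by simp
qed (use assms in auto)

text \<open>After deletion of all cubes of \<open>A\<close> only the zero chain remains; it is a
  boundary, so no member can survive. The bound ensures that the \<open>GREATEST\<close> in a Betti
  number is attained.\<close>

lemma indep_mod_cyc_card:
  assumes "finite A" "indep_mod (cyc A) (bnd C) m"
  shows "m \<le> card A"
proof -
  have "indep_mod (cyc {}) (bnd C) (m - card A)"
    using indep_mod_cyc_remove[of A "{}"] assms by auto
  then obtain I :: "nat set" and z where I: "finite I" "card I = m - card A" "\<And>i. i \<in> I \<Longrightarrow> z i \<in> cyc {}"
    "\<And>a i. (\<lambda>Q. \<Sum>i\<in>I. a i * z i Q) \<in> bnd C \<Longrightarrow> i \<in> I \<Longrightarrow> a i = 0"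
    by (rule indep_modE) (rule that, auto)
  have "bdry (\<lambda>_. 0) = (\<lambda>_. 0)" by (simp add: bdry_def)
  then have 0: "(\<lambda>_. 0) \<in> bnd C"
    unfolding bnd_def by (intro image_eqI[where x = "\<lambda>_. 0"]) simp_all
  have "(\<lambda>Q. \<Sum>i\<in>I. 1 * z i Q) = (\<lambda>_. 0)"
    using I(3) by (auto simp: cyc_def intro!: ext sum.neutral)
  with I(4)[of "\<lambda>_. 1"] 0 have "I = {}" by auto
  then show ?thesis using I(2) by simp
qed

section \<open>Comparison of Betti numbers of nested cubical sets\<close>

lemma betti_eq_Greatest:
  assumes "finite (cubes_in d X k)" "finite (cubes_in d X (Suc k))"
  shows "betti d X k = (GREATEST m. indep_mod (cyc (cubes_in d X k)) (bnd (cubes_in d X (Suc k))) m)"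
proof -
  \<comment> \<open>With finitely many cubes, support in these cubes already means finite
    support.\<close>
  have ch: "chains d X j = {c. \<forall>Q. c Q \<noteq> 0 \<longrightarrow> Q \<in> cubes_in d X j}" if "finite (cubes_in d X j)" for j
    unfolding chains_def using that by (auto intro: finite_subset)
  have c: "cycles d X k = cyc (cubes_in d X k)"
    unfolding cycles_def cyc_def ch[OF assms(1)] by auto
  have b: "boundaries d X k = bnd (cubes_in d X (Suc k))"
    unfolding boundaries_def bnd_def ch[OF assms(2)] by auto
  \<comment> \<open>Lists are traded for families over finite index sets by enumerating the index
    set; families allow a member to be deleted without renumbering.\<close>
  have "(\<exists>zs. length zs = m \<and> set zs \<subseteq> Z \<and>
     (\<forall>a :: nat \<Rightarrow> int. (\<lambda>Q. \<Sum>i<m. a i * (zs ! i) Q) \<in> B \<longrightarrow> (\<forall>i<m. a i = 0)))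
     \<longleftrightarrow> indep_mod Z B m" (is "?L \<longleftrightarrow> ?R") for Z B :: "chain set" and m
  proof
    assume ?L
    then obtain zs where "length zs = m" "set zs \<subseteq> Z"
     "\<forall>a :: nat \<Rightarrow> int. (\<lambda>Q. \<Sum>i<m. a i * (zs ! i) Q) \<in> B \<longrightarrow> (\<forall>i<m. a i = 0)" by blast
    then show ?R
      by (intro indep_modI[of "{..<m}" _ "\<lambda>i. zs ! i"]) (auto dest: nth_mem)
  next
    assume ?R
    then obtain I :: "nat set" and z where I: "finite I" "card I = m" "\<And>i. i \<in> I \<Longrightarrow> z i \<in> Z"
      "\<And>a i. (\<lambda>Q. \<Sum>i\<in>I. a i * z i Q) \<in> B \<Longrightarrow> i \<in> I \<Longrightarrow> a i = 0"
      by (rule indep_modE) (rule that, auto)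
    obtain h where h: "bij_betw h {..<m} I"
      using ex_bij_betw_nat_finite[OF I(1)] I(2) by (auto simp: atLeast0LessThan)
    let ?zs = "map (\<lambda>i. z (h i)) [0..<m]"
    show ?L
    proof (intro exI[of _ ?zs] conjI allI impI)
      show "length ?zs = m" by simp
      show "set ?zs \<subseteq> Z" using h I(3) by (auto simp: bij_betw_def)
    next
      fix a :: "nat \<Rightarrow> int" and i
      assume a: "(\<lambda>Q. \<Sum>i<m. a i * (?zs ! i) Q) \<in> B" and i: "i < m"
      define a' where "a' = a \<circ> the_inv_into {..<m} h"
      have ah: "a' (h i) = a i" if "i < m" for i
        using that h by (simp add: a'_def the_inv_into_f_f bij_betw_def)
      have "(\<Sum>i\<in>I. a' i * z i Q) = (\<Sum>i<m. a i * (?zs ! i) Q)" for Q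
        by (subst sum.reindex_bij_betw[OF h, symmetric]) (simp add: ah)
      with a have "(\<lambda>Q. \<Sum>i\<in>I. a' i * z i Q) \<in> B" by simp
      from I(4)[OF this, of "h i"] show "a i = 0"
        using i ah h by (auto simp: bij_betw_def)
    qed
  qed
  then show ?thesis unfolding betti_def c b by simp
qed

text \<open>A maximal family for \<open>X\<close> stays independent modulo the fewer boundaries of
  \<open>Y\<close> and loses at most one member per deleted \<open>k\<close>-cube. A maximal family
  for \<open>Y\<close> consists of cycles of \<open>X\<close> and loses at most one member per added
  cube of dimension \<open>k + 1\<close>.\<close>

lemma betti_diff_le:
  assumes fin: "finite (cubes_in d X k)" "finite (cubes_in d X (Suc k))" and "Y \<subseteq> X"
    and D: "card (cubes_in d X k - cubes_in d Y k) \<le> D"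
           "card (cubes_in d X (Suc k) - cubes_in d Y (Suc k)) \<le> D"
  shows "\<bar>real (betti d X k) - real (betti d Y k)\<bar> \<le> real D"
proof -
  define A where "A = cubes_in d X k"
  define C where "C = cubes_in d X (Suc k)"
  define A' where "A' = cubes_in d Y k"
  define C' where "C' = cubes_in d Y (Suc k)"
  note defs = A_def C_def A'_def C'_def
  have sub: "A' \<subseteq> A" "C' \<subseteq> C" using \<open>Y \<subseteq> X\<close> unfolding defs cubes_in_def by auto
  have fin': "finite A" "finite C" "finite A'" "finite C'"
    using fin finite_subset[OF sub(1)] finite_subset[OF sub(2)] by (auto simp: A_def C_def)
  have b: "betti d X k = (GREATEST m. indep_mod (cyc A) (bnd C) m)"
          "betti d Y k = (GREATEST m. indep_mod (cyc A') (bnd C') m)"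
    using betti_eq_Greatest[of d X k] betti_eq_Greatest[of d Y k] fin' unfolding defs by simp_all
  have X1: "indep_mod (cyc A) (bnd C) (betti d X k)"
    unfolding b by (rule GreatestI_nat) (rule indep_mod_0, rule indep_mod_cyc_card[OF fin'(1)])
  have Y1: "indep_mod (cyc A') (bnd C') (betti d Y k)"
    unfolding b by (rule GreatestI_nat) (rule indep_mod_0, rule indep_mod_cyc_card[OF fin'(3)])
  have X2: "m \<le> betti d X k" if "indep_mod (cyc A) (bnd C) m" for m
    unfolding b by (rule Greatest_le_nat, rule that) (rule indep_mod_cyc_card[OF fin'(1)])
  have Y2: "m \<le> betti d Y k" if "indep_mod (cyc A') (bnd C') m" for m
    unfolding b by (rule Greatest_le_nat, rule that) (rule indep_mod_cyc_card[OF fin'(3)])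
  have "indep_mod (cyc (A' \<union> (A - A'))) (bnd C') (betti d X k)"
    using indep_mod_mono[OF X1 subset_refl bnd_mono[OF sub(2)]] sub(1) by (simp add: Un_absorb1)
  then have "indep_mod (cyc A') (bnd C') (betti d X k - card (A - A'))"
    by (rule indep_mod_cyc_remove[rotated 2]) (use fin' in auto)
  then have 1: "betti d X k \<le> betti d Y k + D" using Y2 D(1) unfolding defs by fastforce
  have "indep_mod (cyc A) (bnd C') (betti d Y k)"
    using Y1 cyc_mono[OF sub(1)] subset_refl by (rule indep_mod_mono)
  then have "indep_mod (cyc A) (bnd (C' \<union> (C - C'))) (betti d Y k - card (C - C'))"
    by (rule indep_mod_bnd_add[rotated 3]) (use fin' in auto)
  then have "indep_mod (cyc A) (bnd C) (betti d Y k - card (C - C'))"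
    using sub by (simp add: Un_absorb1)
  then have 2: "betti d Y k \<le> betti d X k + D" using X2 D(2) unfolding defs by fastforce
  from 1 2 show ?thesis by linarith
qed

section \<open>A maximal inequality for ergodic lattice actions\<close>

lemma list_all2_Cons_set:
  "{ys. list_all2 r (x # xs) ys} = (\<lambda>(y, ys). y # ys) ` ({y. r x y} \<times> {ys. list_all2 r xs ys})"
  by (auto simp: list_all2_Cons1)

text \<open>Counts independent choices per coordinate; it serves both for lattice boxes and for
  faces of cubes.\<close>

lemma finite_card_list_all2:
  assumes "\<And>x. x \<in> set xs \<Longrightarrow> finite {y. r x y}"
  shows "finite {ys. list_all2 r xs ys} \<and> card {ys. list_all2 r xs ys} = (\<Prod>x\<leftarrow>xs. card {y. r x y})"
  using assms
proof (induction xs)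
  case (Cons x xs)
  have "inj_on (\<lambda>(y, ys). y # ys) S" for S :: "('b \<times> 'b list) set" by (auto simp: inj_on_def)
  then show ?case using Cons unfolding list_all2_Cons_set
    by (simp add: card_image card_cartesian_product)
next
  case Nil
  have "{ys. list_all2 r [] ys} = {[]}" by auto
  then show ?case by simp
qed

definition lattice_box :: "int list \<Rightarrow> nat \<Rightarrow> int list set" where
  "lattice_box x n = {y. list_all2 (\<lambda>a b. \<bar>b - a\<bar> \<le> int n) x y}"

lemma lattice_box_finite_card: "finite (lattice_box x n) \<and> card (lattice_box x n) = (2 * n + 1) ^ length x"
proof -
  have eq: "{b. \<bar>b - a\<bar> \<le> int n} = {a - int n .. a + int n}" for a by auto
  have "finite (lattice_box x n) \<and> card (lattice_box x n) = (\<Prod>a\<leftarrow>x. card {b. \<bar>b - a\<bar> \<le> int n})"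
    unfolding lattice_box_def
    using finite_card_list_all2[of x "\<lambda>a b. \<bar>b - a\<bar> \<le> int n"] by (simp add: eq)
  also have "(\<Prod>a\<leftarrow>x. card {b. \<bar>b - a\<bar> \<le> int n}) = (2 * n + 1) ^ length x"
    unfolding eq by (induction x) (auto simp: nat_add_distrib nat_mult_distrib)
  finally show ?thesis .
qed

lemma finite_lattice_box [simp]: "finite (lattice_box x n)"
  and card_lattice_box: "card (lattice_box x n) = (2 * n + 1) ^ length x"
  using lattice_box_finite_card by auto

lemma real_card_lattice_box: "real (card (lattice_box x n)) = (2 * real n + 1) ^ length x"
  by (simp add: card_lattice_box add.commute)

lemma lattice_box_iff: "y \<in> lattice_box x n \<longleftrightarrow> length y = length x \<and> (\<forall>i<length x. \<bar>y ! i - x ! i\<bar> \<le> int n)"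
  by (auto simp: lattice_box_def list_all2_conv_all_nth)

lemma center_in_lattice_box [simp]: "x \<in> lattice_box x n" by (simp add: lattice_box_iff)

lemma lattice_box_trans:
  assumes "y \<in> lattice_box x n" "z \<in> lattice_box y m" "n + m \<le> k" shows "z \<in> lattice_box x k"
proof -
  have "\<bar>z ! i - x ! i\<bar> \<le> int k" if "i < length x" for i
  proof -
    have "\<bar>z ! i - y ! i\<bar> \<le> int m" "\<bar>y ! i - x ! i\<bar> \<le> int n" using assms that by (auto simp: lattice_box_iff)
    then show ?thesis using assms(3) by linarith
  qed
  then show ?thesis using assms by (auto simp: lattice_box_iff)
qed

lemma lattice_box_sym: "y \<in> lattice_box x n \<Longrightarrow> x \<in> lattice_box y n"
  by (auto simp: lattice_box_iff abs_minus_commute)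

text \<open>Greedy choice: keep a box of largest radius, discard those meeting it, recurse. The
  centre of a discarded box lies within \<open>n x + n y \<le> 2 * n x\<close> of \<open>x\<close>.
  Only centres have to be covered, so doubling the radius is enough.\<close>

lemma vitali_lattice_boxes:
  assumes "finite G"
  shows "\<exists>H\<subseteq>G. disjoint_family_on (\<lambda>x. lattice_box x (n x)) H \<and> G \<subseteq> (\<Union>x\<in>H. lattice_box x (2 * n x))"
  using assms
proof (induction G rule: finite_psubset_induct)
  case (psubset G)
  show ?case
  proof (cases "G = {}")
    case False
    then have "Max (n ` G) \<in> n ` G" using psubset.hyps by (intro Max_in) auto
    then obtain x where x: "x \<in> G" "Max (n ` G) = n x" by blast
    have x_max: "n y \<le> n x" if "y \<in> G" for y
      using psubset.hyps that Max_ge[of "n ` G" "n y"] x(2) by simp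
    define G' where "G' = {y \<in> G. lattice_box y (n y) \<inter> lattice_box x (n x) = {}}"
    have "x \<notin> G'" unfolding G'_def using center_in_lattice_box by blast
    then have "G' \<subset> G" using x(1) unfolding G'_def by blast
    from psubset.IH[OF this] obtain H where H: "H \<subseteq> G'" "disjoint_family_on (\<lambda>x. lattice_box x (n x)) H"
      "G' \<subseteq> (\<Union>x\<in>H. lattice_box x (2 * n x))" by blast
    show ?thesis
    proof (intro exI[of _ "insert x H"] conjI)
      show "insert x H \<subseteq> G" using H(1) x(1) G'_def by blast
      show "disjoint_family_on (\<lambda>x. lattice_box x (n x)) (insert x H)"
        using H(1,2) unfolding disjoint_family_on_def G'_def by blast
      show "G \<subseteq> (\<Union>x\<in>insert x H. lattice_box x (2 * n x))"
      proof
        fix y assume y: "y \<in> G"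
        show "y \<in> (\<Union>x\<in>insert x H. lattice_box x (2 * n x))"
        proof (cases "y \<in> G'")
          case False
          then obtain z where z: "z \<in> lattice_box y (n y)" "z \<in> lattice_box x (n x)"
            using y unfolding G'_def by blast
          have "y \<in> lattice_box x (2 * n x)"
            by (rule lattice_box_trans[OF z(2) lattice_box_sym[OF z(1)]]) (use x_max[OF y] in simp)
          then show ?thesis by blast
        qed (use H(3) in blast)
      qed
    qed
  qed (auto simp: disjoint_family_on_def)
qed

text \<open>The doubled Vitali boxes cover \<open>G\<close>, so \<open>card G\<close> is at most
  \<open>2 ^ d\<close> times the total size of the disjoint boxes, with \<open>d\<close> the length
  of \<open>x0\<close>. On each of these the sum of \<open>F\<close> exceeds \<open>lam\<close>
  times the size, and all of them lie in the box of radius \<open>K + N\<close>.\<close>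

lemma vitali_count:
  fixes F :: "int list \<Rightarrow> real"
  assumes F: "\<And>y. F y \<ge> 0" and lam: "lam \<ge> 0" and G: "G \<subseteq> lattice_box x0 K"
    and large: "\<And>x. x \<in> G \<Longrightarrow> \<exists>n\<le>N. lam * (2 * real n + 1) ^ length x0 < (\<Sum>y\<in>lattice_box x n. F y)"
  shows "lam * real (card G) \<le> 2 ^ length x0 * (\<Sum>y\<in>lattice_box x0 (K + N). F y)"
proof -
  let ?d = "length x0"
  obtain n where n: "\<And>x. x \<in> G \<Longrightarrow> n x \<le> N"
    "\<And>x. x \<in> G \<Longrightarrow> lam * (2 * real (n x) + 1) ^ ?d < (\<Sum>y\<in>lattice_box x (n x). F y)"
  proof -
    have "\<forall>x\<in>G. \<exists>n. n \<le> N \<and> lam * (2 * real n + 1) ^ ?d < (\<Sum>y\<in>lattice_box x n. F y)"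
      using large by blast
    from bchoice[OF this] show ?thesis using that by auto
  qed
  have finG: "finite G" by (rule finite_subset[OF G finite_lattice_box])
  obtain H where H: "H \<subseteq> G" "disjoint_family_on (\<lambda>x. lattice_box x (n x)) H"
    "G \<subseteq> (\<Union>x\<in>H. lattice_box x (2 * n x))" using vitali_lattice_boxes[OF finG, of n] by blast
  have finH: "finite H" by (rule finite_subset[OF H(1) finG])
  have len: "length x = ?d" if "x \<in> H" for x using that H(1) G by (auto simp: lattice_box_iff)
  have "card G \<le> card (\<Union>x\<in>H. lattice_box x (2 * n x))"
    using H(3) finH by (intro card_mono) auto
  also have "\<dots> \<le> (\<Sum>x\<in>H. card (lattice_box x (2 * n x)))" using finH by (rule card_UN_le)
  also have "\<dots> = (\<Sum>x\<in>H. (2 * (2 * n x) + 1) ^ ?d)" by (intro sum.cong) (auto simp: card_lattice_box len)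
  \<comment> \<open>The constant \<open>2 ^ d\<close> of the maximal inequality originates here,
    from \<open>4 * n + 1 \<le> 2 * (2 * n + 1)\<close>.\<close>
  also have "\<dots> \<le> (\<Sum>x\<in>H. (2 * (2 * n x + 1)) ^ ?d)" by (intro sum_mono power_mono) auto
  finally have "real (card G) \<le> real (\<Sum>x\<in>H. (2 * (2 * n x + 1)) ^ ?d)" by (rule of_nat_mono)
  also have "\<dots> = 2 ^ ?d * (\<Sum>x\<in>H. (2 * real (n x) + 1) ^ ?d)"
    unfolding of_nat_sum sum_distrib_left
    by (intro sum.cong refl) (simp add: add.commute flip: power_mult_distrib)
  finally have "lam * real (card G) \<le> lam * (2 ^ ?d * (\<Sum>x\<in>H. (2 * real (n x) + 1) ^ ?d))"
    using lam by (rule mult_left_mono)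
  also have "\<dots> = 2 ^ ?d * (\<Sum>x\<in>H. lam * (2 * real (n x) + 1) ^ ?d)"
    by (simp add: sum_distrib_left algebra_simps)
  also have "(\<Sum>x\<in>H. lam * (2 * real (n x) + 1) ^ ?d) \<le> (\<Sum>x\<in>H. \<Sum>y\<in>lattice_box x (n x). F y)"
    using n(2) H(1) by (intro sum_mono less_imp_le) auto
  also have "\<dots> = (\<Sum>y\<in>(\<Union>x\<in>H. lattice_box x (n x)). F y)"
    using finH H(2) by (intro sum.UNION_disjoint[symmetric]) (auto simp: disjoint_family_on_def)
  also have "\<dots> \<le> (\<Sum>y\<in>lattice_box x0 (K + N). F y)"
  proof (intro sum_mono2)
    show "(\<Union>x\<in>H. lattice_box x (n x)) \<subseteq> lattice_box x0 (K + N)"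
    proof (intro UN_least subsetI)
      fix x y assume "x \<in> H" "y \<in> lattice_box x (n x)"
      then show "y \<in> lattice_box x0 (K + N)" using H(1) G n(1) by (intro lattice_box_trans[of x x0 K y "n x"]) auto
    qed
  qed (use F in auto)
  finally show ?thesis by simp
qed

section \<open>Orbit sums of measure-preserving lattice actions\<close>

definition ladd :: "int list \<Rightarrow> int list \<Rightarrow> int list" where
  "ladd x y = map2 (+) x y"

lemma length_ladd [simp]: "length (ladd x y) = min (length x) (length y)"
  by (simp add: ladd_def)

lemma nth_ladd [simp]: "i < length x \<Longrightarrow> i < length y \<Longrightarrow> ladd x y ! i = x ! i + y ! i"
  by (simp add: ladd_def)

abbreviation origin :: "nat \<Rightarrow> int list" where "origin d \<equiv> replicate d 0"

text \<open>As in \<open>ergodic\<close>, the zero-one law covers exactly invariant events, so an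
  event must be shown to be invariant at every point before the law applies.\<close>

locale lattice_action = prob_space P for P :: "'a measure" +
  fixes d :: nat and T :: "int list \<Rightarrow> 'a \<Rightarrow> 'a"
  assumes T_measurable: "length x = d \<Longrightarrow> T x \<in> measurable P P"
    and T_preserves: "length x = d \<Longrightarrow> distr P P (T x) = P"
    and T_add: "length x = d \<Longrightarrow> length y = d \<Longrightarrow> \<omega> \<in> space P \<Longrightarrow> T y (T x \<omega>) = T (ladd x y) \<omega>"
    and T_ergodic: "A \<in> sets P \<Longrightarrow> (\<And>x. length x = d \<Longrightarrow> T x -` A \<inter> space P = A) \<Longrightarrow> prob A = 0 \<or> prob A = 1"
begin

context
  fixes f :: "'a \<Rightarrow> real"
  assumes f_int: "integrable P f" and f_nonneg: "\<And>\<omega>. f \<omega> \<ge> 0"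
begin

definition box_sum :: "int list \<Rightarrow> nat \<Rightarrow> 'a \<Rightarrow> real" where
  "box_sum x n \<omega> = (\<Sum>y\<in>lattice_box x n. f (T y \<omega>))"

lemma T_space: "length x = d \<Longrightarrow> \<omega> \<in> space P \<Longrightarrow> T x \<omega> \<in> space P"
  using T_measurable measurable_space by metis

lemma f_T_measurable: "length x = d \<Longrightarrow> (\<lambda>\<omega>. f (T x \<omega>)) \<in> borel_measurable P"
  using T_measurable f_int by (auto intro: measurable_compose)

lemma integral_comp_T:
  assumes "length x = d" "g \<in> borel_measurable P"
  shows "(\<integral>\<omega>. g (T x \<omega>) \<partial>P) = (\<integral>\<omega>. g \<omega> \<partial>P :: real)"
  using integral_distr[OF T_measurable[OF assms(1)], of g] assms T_preserves by simp

lemma integrable_comp_T: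
  assumes "length x = d" "integrable P (g :: 'a \<Rightarrow> real)"
  shows "integrable P (\<lambda>\<omega>. g (T x \<omega>))"
  using integrable_distr_eq[OF T_measurable[OF assms(1)], of g] assms T_preserves by auto

lemma box_sum_measurable: "length x = d \<Longrightarrow> box_sum x n \<in> borel_measurable P"
  unfolding box_sum_def by (intro borel_measurable_sum f_T_measurable) (auto simp: lattice_box_iff)

lemma box_sum_T:
  assumes "length x = d" "\<omega> \<in> space P"
  shows "box_sum (origin d) n (T x \<omega>) = box_sum x n \<omega>"
  unfolding box_sum_def
proof (rule sum.reindex_bij_witness[where j = "\<lambda>y. ladd x y" and i = "\<lambda>y. ladd y (map uminus x)"])
  fix y assume y: "y \<in> lattice_box (origin d) n"
  then show "ladd (ladd x y) (map uminus x) = y" using assms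
    by (auto simp: lattice_box_iff list_eq_iff_nth_eq)
  show "ladd x y \<in> lattice_box x n" using y assms by (auto simp: lattice_box_iff)
  show "f (T (ladd x y) \<omega>) = f (T y (T x \<omega>))" using T_add[of x y \<omega>] assms y by (simp add: lattice_box_iff)
next
  fix y assume y: "y \<in> lattice_box x n"
  then show "ladd x (ladd y (map uminus x)) = y" using assms
    by (auto simp: lattice_box_iff list_eq_iff_nth_eq)
  show "ladd y (map uminus x) \<in> lattice_box (origin d) n" using y assms by (auto simp: lattice_box_iff)
qed

text \<open>Transference: the covering bound is applied along each orbit to the points of a box of
  radius \<open>K\<close> that visit the event. Integration turns both sides into volume times a
  constant by invariance, and \<open>K\<close> is sent to infinity.\<close>

lemma maximal_inequality:
  assumes lam: "lam \<ge> 0"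
  shows "lam * prob {\<omega>\<in>space P. \<exists>n\<le>N. lam * (2 * real n + 1) ^ d < box_sum (origin d) n \<omega>}
           \<le> 2 ^ d * (\<integral>\<omega>. f \<omega> \<partial>P)" (is "_ * prob ?E \<le> _")
proof -
  have [measurable]: "box_sum (origin d) n \<in> borel_measurable P" for n
    by (rule box_sum_measurable) simp
  have E: "?E \<in> sets P" by measurable
  have fin: "lam * (2 * real K + 1) ^ d * prob ?E \<le> 2 ^ d * ((2 * real (K + N) + 1) ^ d * (\<integral>\<omega>. f \<omega> \<partial>P))" for K
  proof -
    have len: "x \<in> lattice_box (origin d) m \<Longrightarrow> length x = d" for x m by (simp add: lattice_box_iff)
    have ind: "integrable P (indicator ?E :: 'a \<Rightarrow> real)" using E by (simp add: emeasure_eq_measure)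
    \<comment> \<open>By \<open>box_sum_T\<close>, \<open>T x \<omega>\<close> lies in the event
      exactly when some box of radius at most \<open>N\<close> about \<open>x\<close> has a large
      orbit sum, which is the hypothesis of \<open>vitali_count\<close>.\<close>
    have pw: "lam * (\<Sum>x\<in>lattice_box (origin d) K. indicator ?E (T x \<omega>)) \<le> 2 ^ d * box_sum (origin d) (K + N) \<omega>"
      if \<omega>: "\<omega> \<in> space P" for \<omega>
    proof -
      let ?G = "{x \<in> lattice_box (origin d) K. T x \<omega> \<in> ?E}"
      have "(\<Sum>x\<in>lattice_box (origin d) K. indicator ?E (T x \<omega>) :: real) = real (card ?G)"
        by (simp add: indicator_def sum.If_cases Int_def)
      moreover have "lam * real (card ?G) \<le> 2 ^ length (origin d) * (\<Sum>y\<in>lattice_box (origin d) (K + N). f (T y \<omega>))"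
      proof (rule vitali_count)
        fix x assume "x \<in> ?G"
        then show "\<exists>n\<le>N. lam * (2 * real n + 1) ^ length (origin d) < (\<Sum>y\<in>lattice_box x n. f (T y \<omega>))"
          using box_sum_T[of x \<omega>] len[of x K] \<omega> by (simp add: box_sum_def)
      qed (use f_nonneg lam in auto)
      ultimately show ?thesis by (simp add: box_sum_def)
    qed
    have "lam * (2 * real K + 1) ^ d * prob ?E = lam * (\<Sum>x\<in>lattice_box (origin d) K. prob ?E)"
      by (simp add: real_card_lattice_box)
    also have "\<dots> = lam * (\<Sum>x\<in>lattice_box (origin d) K. \<integral>\<omega>. indicator ?E (T x \<omega>) \<partial>P)"
      using E len by (simp add: integral_comp_T)
    also have "\<dots> = (\<integral>\<omega>. lam * (\<Sum>x\<in>lattice_box (origin d) K. indicator ?E (T x \<omega>)) \<partial>P)"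
      using len integrable_comp_T[OF _ ind] by (simp add: Bochner_Integration.integral_sum)
    also have "\<dots> \<le> (\<integral>\<omega>. 2 ^ d * box_sum (origin d) (K + N) \<omega> \<partial>P)"
      using pw len integrable_comp_T[OF _ ind] integrable_comp_T[OF _ f_int]
      by (intro integral_mono) (auto simp: box_sum_def intro!: Bochner_Integration.integrable_sum)
    also have "\<dots> = 2 ^ d * (\<Sum>x\<in>lattice_box (origin d) (K + N). \<integral>\<omega>. f (T x \<omega>) \<partial>P)"
      unfolding box_sum_def using len integrable_comp_T[OF _ f_int] by (simp add: Bochner_Integration.integral_sum)
    also have "\<dots> = 2 ^ d * (\<Sum>x\<in>lattice_box (origin d) (K + N). \<integral>\<omega>. f \<omega> \<partial>P)"
      using len f_int by (simp add: integral_comp_T)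
    finally show ?thesis by (simp add: real_card_lattice_box)
  qed
  \<comment> \<open>With \<open>N\<close> fixed, the boxes of radius \<open>K + N\<close> and
    \<open>K\<close> have asymptotically equal volumes.\<close>
  have lim: "(\<lambda>K. 2 ^ d * (((2 * real (K + N) + 1) / (2 * real K + 1)) ^ d * (\<integral>\<omega>. f \<omega> \<partial>P))) 
      \<longlonglongrightarrow> 2 ^ d * (1 ^ d * (\<integral>\<omega>. f \<omega> \<partial>P))"
    by (intro tendsto_intros) real_asymp
  have bound: "lam * prob ?E \<le> 2 ^ d * (((2 * real (K + N) + 1) / (2 * real K + 1)) ^ d * (\<integral>\<omega>. f \<omega> \<partial>P))" for K
    using fin[of K] by (simp add: power_divide field_simps)
  have "lam * prob ?E \<le> 2 ^ d * (1 ^ d * (\<integral>\<omega>. f \<omega> \<partial>P))"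
    by (rule LIMSEQ_le_const[OF lim]) (use bound in blast)
  then show ?thesis by simp
qed

text \<open>The event of a large upper limit is invariant, so its probability is 0 or 1; the maximal
  inequality bounds it by \<open>2 ^ d\<close> times the integral divided by \<open>mu\<close>,
  which is below 1.\<close>

lemma AE_eventually_box_sum_le:
  assumes lam: "2 ^ d * (\<integral>\<omega>. f \<omega> \<partial>P) < lam"
  shows "AE \<omega> in P. \<forall>\<^sub>F n in sequentially. box_sum (origin d) n \<omega> \<le> lam * (2 * real n + 1) ^ d"
proof -
  have [measurable]: "box_sum (origin d) n \<in> borel_measurable P" for n
    by (rule box_sum_measurable) simp
  have "0 \<le> 2 ^ d * (\<integral>\<omega>. f \<omega> \<partial>P)" using f_nonneg by simp
  obtain mu where mu: "2 ^ d * (\<integral>\<omega>. f \<omega> \<partial>P) < mu" "mu < lam" using lam dense by blast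
  have mu0: "mu > 0" using mu \<open>0 \<le> 2 ^ d * _\<close> by simp
  \<comment> \<open>\<open>E\<close> is the event that the upper limit exceeds \<open>mu\<close>; the margin \<open>1 / Suc k\<close> absorbs the ratio of
    box volumes under a shift, which makes \<open>E\<close> exactly invariant.\<close>
  define c where "c k = mu + 1 / real (Suc k)" for k
  define E where "E = {\<omega>\<in>space P. \<exists>k. \<forall>m. \<exists>n\<ge>m. c k * (2 * real n + 1) ^ d < box_sum (origin d) n \<omega>}"
  have E: "E \<in> sets P" unfolding E_def by measurable
  \<comment> \<open>The box of radius \<open>n\<close> about \<open>x\<close> lies in the box of
    radius \<open>n + r\<close> about the origin, and \<open>f\<close> is nonnegative. The volume
    ratio tends to 1, so the loss is covered by passing from \<open>c k\<close> to the smaller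
    \<open>c (Suc k)\<close>.\<close>
  have step: "\<omega> \<in> E" if x: "length x = d" and \<omega>: "\<omega> \<in> space P" and TE: "T x \<omega> \<in> E" for x \<omega>
  proof -
    obtain k where k: "\<And>m. \<exists>n\<ge>m. c k * (2 * real n + 1) ^ d < box_sum x n \<omega>"
      using TE box_sum_T[OF x \<omega>] unfolding E_def by auto
    define r where "r = nat (Max (insert 0 (abs ` set x)))"
    have r: "\<bar>x ! i\<bar> \<le> int r" if "i < d" for i
      unfolding r_def using that x by (auto intro!: Max_ge)
    have x_box: "x \<in> lattice_box (origin d) r" using r x by (auto simp: lattice_box_iff)
    have sub: "lattice_box x n \<subseteq> lattice_box (origin d) (n + r)" for n
      using lattice_box_trans[OF x_box, of _ n "n + r"] by auto
    have "(\<lambda>n. ((2 * real (n + r) + 1) / (2 * real n + 1)) ^ d * c (Suc k)) \<longlonglongrightarrow> 1 ^ d * c (Suc k)"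
      by (intro tendsto_intros) real_asymp
    moreover have "1 ^ d * c (Suc k) < c k" by (simp add: c_def field_simps)
    ultimately have "\<forall>\<^sub>F n in sequentially. ((2 * real (n + r) + 1) / (2 * real n + 1)) ^ d * c (Suc k) < c k"
      by (rule order_tendstoD)
    then obtain n0 where n0: "\<And>n. n \<ge> n0 \<Longrightarrow> ((2 * real (n + r) + 1) / (2 * real n + 1)) ^ d * c (Suc k) < c k"
      by (auto simp: eventually_sequentially)
    have "\<exists>n\<ge>m. c (Suc k) * (2 * real n + 1) ^ d < box_sum (origin d) n \<omega>" for m
    proof -
      obtain n where n: "n \<ge> max m n0" "c k * (2 * real n + 1) ^ d < box_sum x n \<omega>" using k by blast
      have "((2 * real (n + r) + 1) / (2 * real n + 1)) ^ d * c (Suc k) < c k" using n0 n by simp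
      then have "c (Suc k) * (2 * real (n + r) + 1) ^ d < c k * (2 * real n + 1) ^ d"
        by (simp add: power_divide field_simps)
      also have "\<dots> < box_sum x n \<omega>" by fact
      also have "\<dots> \<le> box_sum (origin d) (n + r) \<omega>"
        unfolding box_sum_def using sub f_nonneg by (intro sum_mono2) auto
      finally show ?thesis using n(1) by (intro exI[of _ "n + r"]) simp
    qed
    then show ?thesis using \<omega> unfolding E_def by blast
  qed
  have "T x -` E \<inter> space P = E" if x: "length x = d" for x
  proof (intro equalityI subsetI)
    fix \<omega> assume "\<omega> \<in> T x -` E \<inter> space P"
    then show "\<omega> \<in> E" using step x by blast
  next
    \<comment> \<open>The reverse inclusion is \<open>step\<close> for the inverse translation,
      applied at \<open>T x \<omega>\<close>.\<close>
    fix \<omega> assume \<omega>: "\<omega> \<in> E"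
    then have sp: "\<omega> \<in> space P" by (simp add: E_def)
    let ?y = "map uminus x"
    have "ladd x ?y = origin d" using x by (auto simp: list_eq_iff_nth_eq)
    then have "T ?y (T x \<omega>) = T (origin d) \<omega>" using T_add[of x ?y \<omega>] x sp by simp
    moreover have "T (origin d) \<omega> \<in> E"
      using \<omega> box_sum_T[of "origin d" \<omega>] T_space[of "origin d" \<omega>] sp by (simp add: E_def)
    ultimately have "T x \<omega> \<in> E" using step[of ?y "T x \<omega>"] x T_space[OF x sp] by simp
    then show "\<omega> \<in> T x -` E \<inter> space P" using sp by simp
  qed
  then have "prob E = 0 \<or> prob E = 1" using T_ergodic[OF E] by blast
  moreover have "mu * prob E \<le> 2 ^ d * (\<integral>\<omega>. f \<omega> \<partial>P)"
  proof -
    \<comment> \<open>The events \<open>D N\<close> increase with \<open>N\<close>, and their union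
      contains \<open>E\<close> because \<open>mu \<le> c k\<close>.\<close>
    define D where "D N = {\<omega>\<in>space P. \<exists>n\<le>N. mu * (2 * real n + 1) ^ d < box_sum (origin d) n \<omega>}" for N :: nat
    have D: "D N \<in> sets P" for N unfolding D_def by measurable
    have "incseq D" unfolding incseq_def D_def using order_trans by blast
    then have "(\<lambda>N. prob (D N)) \<longlonglongrightarrow> prob (\<Union>N. D N)"
      using D by (intro finite_Lim_measure_incseq) auto
    then have lim: "(\<lambda>N. mu * prob (D N)) \<longlonglongrightarrow> mu * prob (\<Union>N. D N)" by (intro tendsto_intros)
    have "mu * prob (D N) \<le> 2 ^ d * (\<integral>\<omega>. f \<omega> \<partial>P)" for N
      using maximal_inequality[of mu N] mu0 unfolding D_def by simp
    then have "mu * prob (\<Union>N. D N) \<le> 2 ^ d * (\<integral>\<omega>. f \<omega> \<partial>P)"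
      by (intro LIMSEQ_le_const2[OF lim]) blast
    moreover have "E \<subseteq> (\<Union>N. D N)"
    proof
      fix \<omega> assume "\<omega> \<in> E"
      then obtain k n where "\<omega> \<in> space P" "c k * (2 * real n + 1) ^ d < box_sum (origin d) n \<omega>"
        unfolding E_def by blast
      moreover have "mu * (2 * real n + 1) ^ d \<le> c k * (2 * real n + 1) ^ d"
        by (intro mult_right_mono) (auto simp: c_def)
      ultimately have "\<omega> \<in> space P" "mu * (2 * real n + 1) ^ d < box_sum (origin d) n \<omega>"
        by (blast, linarith)
      then have "\<omega> \<in> D n" unfolding D_def by blast
      then show "\<omega> \<in> (\<Union>N. D N)" by blast
    qed
    then have "prob E \<le> prob (\<Union>N. D N)" using D by (intro finite_measure_mono) auto
    then have "mu * prob E \<le> mu * prob (\<Union>N. D N)" using mu0 by (intro mult_left_mono) auto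
    ultimately show ?thesis by linarith
  qed
  ultimately have "prob E = 0" using mu by auto
  then have "AE \<omega> in P. \<omega> \<notin> E" using E by (simp add: prob_eq_0)
  then show ?thesis
  proof (rule AE_mp, intro AE_I2 impI)
    fix \<omega> assume \<omega>: "\<omega> \<in> space P" and nE: "\<omega> \<notin> E"
    \<comment> \<open>This choice gives \<open>c k \<le> lam\<close>.\<close>
    obtain k where k: "1 / real (Suc k) < lam - mu"
      using mu(2) nat_approx_posE[of "lam - mu"] by auto
    from nE \<omega> obtain m where m: "\<And>n. n \<ge> m \<Longrightarrow> \<not> c k * (2 * real n + 1) ^ d < box_sum (origin d) n \<omega>"
      unfolding E_def by blast
    show "\<forall>\<^sub>F n in sequentially. box_sum (origin d) n \<omega> \<le> lam * (2 * real n + 1) ^ d"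
      unfolding eventually_sequentially
    proof (intro exI[of _ m] allI impI)
      fix n assume "n \<ge> m"
      then have "box_sum (origin d) n \<omega> \<le> c k * (2 * real n + 1) ^ d" using m by force
      also have "\<dots> \<le> lam * (2 * real n + 1) ^ d" using k by (intro mult_right_mono) (auto simp: c_def)
      finally show "box_sum (origin d) n \<omega> \<le> lam * (2 * real n + 1) ^ d" .
    qed
  qed
qed

lemmas AE_eventually_sum_orbit_le = AE_eventually_box_sum_le[unfolded box_sum_def]

end

end

section \<open>Cubes entering between two levels\<close>

text \<open>An elementary cube inside a union of elementary cubes already lies in one of them, namely in
any that contains its midpoint.\<close>
lemma cube_set_subset_of_midpoint:
  assumes "length R = length Q"
    and mid: "map (\<lambda>I. real_of_int (fst I) + (if snd I then 1/2 else 0)) Q \<in> cube_set R"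
  shows "list_all2 (\<lambda>r q. q = r \<or> q = (fst r, False) \<or> q = (fst r + 1, False)) R Q"
    and "cube_set Q \<subseteq> cube_set R"
proof -
  have coord: "q = r \<or> q = (fst r, False) \<or> q = (fst r + 1, False)"
    if "real_of_int (fst q) + (if snd q then 1/2 else 0) \<in> eint_set r" for q r
  proof (cases "snd q")
    case True
    then have b: "real_of_int (fst q) + 1/2 \<in> eint_set r" using that by simp
    \<comment> \<open>The midpoint of a nondegenerate interval is a proper half-integer and cannot
      be a lattice point; doubling makes this a parity contradiction.\<close>
    have sr: "snd r"
    proof (rule ccontr)
      assume "\<not> snd r"
      then have "real_of_int (2 * fst q + 1) = real_of_int (2 * fst r)" using b by (simp add: eint_set_def)
      then have "2 * fst q + 1 = 2 * fst r" unfolding of_int_eq_iff .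
      then show False by presburger
    qed
    then have "real_of_int (fst r) \<le> real_of_int (fst q) + 1/2" "real_of_int (fst q) \<le> real_of_int (fst r) + 1/2"
      using b by (auto simp: eint_set_def)
    then have "fst q = fst r" by linarith
    with True sr show ?thesis by (simp add: prod_eq_iff)
  next
    case False
    then have "real_of_int (fst q) \<in> eint_set r" using that by simp
    then have "fst r \<le> fst q \<and> fst q \<le> fst r + 1"
      by (auto simp: eint_set_def split: if_splits)
    then have "fst q = fst r \<or> fst q = fst r + 1" by linarith
    then show ?thesis using False by (auto simp: prod_eq_iff)
  qed
  have c: "Q ! i = R ! i \<or> Q ! i = (fst (R ! i), False) \<or> Q ! i = (fst (R ! i) + 1, False)"
    and m: "real_of_int (fst (Q ! i)) + (if snd (Q ! i) then 1/2 else 0) \<in> eint_set (R ! i)"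
    if "i < length R" for i
    using mid that assms(1) coord[of "Q ! i" "R ! i"] by (auto simp: cube_set_def)
  show "list_all2 (\<lambda>r q. q = r \<or> q = (fst r, False) \<or> q = (fst r + 1, False)) R Q"
    unfolding list_all2_conv_all_nth using c assms(1) by simp
  have "eint_set (Q ! i) \<subseteq> eint_set (R ! i)" if "i < length R" for i
    using c[OF that] m[OF that] by (auto simp: eint_set_def split: if_splits)
  then show "cube_set Q \<subseteq> cube_set R"
    using assms(1) unfolding cube_set_def by auto
qed

text \<open>An overestimate of the faces of \<open>R\<close>: at a degenerate factor
  \<open>[l]\<close> the entry \<open>[l+1]\<close> is allowed as well, so that every factor has at
  most three alternatives whatever its type.\<close>

definition faces :: "ecube \<Rightarrow> ecube set" where
  "faces R = {Q. list_all2 (\<lambda>r q. q = r \<or> q = (fst r, False) \<or> q = (fst r + 1, False)) R Q}"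

lemma finite_faces: "finite (faces R)" and card_faces_le: "card (faces R) \<le> 3 ^ length R"
proof -
  let ?r = "\<lambda>r q :: eint. q = r \<or> q = (fst r, False) \<or> q = (fst r + 1, False)"
  have eq: "{q. ?r r q} = {r, (fst r, False), (fst r + 1, False)}" for r by auto
  have fc: "finite (faces R) \<and> card (faces R) = (\<Prod>r\<leftarrow>R. card {q. ?r r q})"
    unfolding faces_def by (rule finite_card_list_all2) (simp add: eq)
  have "card {q. ?r r q} \<le> 3" for r
    unfolding eq using card_length[of "[r, (fst r, False), (fst r + 1, False)]"] by simp
  then have "(\<Prod>r\<leftarrow>R. card {q. ?r r q}) \<le> 3 ^ length R"
    by (induction R) (simp_all add: mult_le_mono)
  then show "finite (faces R)" "card (faces R) \<le> 3 ^ length R" using fc by auto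
qed

text \<open>The condition concerns left endpoints, so a member may protrude from
  \<open>Lambda d n\<close> on the right.\<close>

definition cubes_box :: "nat \<Rightarrow> nat \<Rightarrow> ecube set" where
  "cubes_box d n = {R \<in> elem_cubes d. \<forall>i<d. \<bar>fst (R ! i)\<bar> \<le> int n}"

lemma finite_cubes_box: "finite (cubes_box d n)"
proof (rule finite_subset)
  show "cubes_box d n \<subseteq> {R. set R \<subseteq> {- int n..int n} \<times> UNIV \<and> length R = d}"
    unfolding cubes_box_def elem_cubes_def by (force simp: in_set_conv_nth)
  show "finite {R. set R \<subseteq> {- int n..int n} \<times> (UNIV :: bool set) \<and> length R = d}"
    by (intro finite_lists_length_eq) auto
qed

lemma cubes_in_Lambda:
  assumes "Q \<in> elem_cubes d" "cube_set Q \<subseteq> Lambda d n"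
  shows "Q \<in> cubes_box d n"
proof -
  have "map (\<lambda>I. real_of_int (fst I)) Q \<in> cube_set Q"
    by (auto simp: cube_set_def eint_set_def)
  then have "map (\<lambda>I. real_of_int (fst I)) Q \<in> Lambda d n" using assms by blast
  then have "\<bar>real_of_int (fst (Q ! i))\<bar> \<le> real n" if "i < d" for i
    using that assms(1) by (auto simp: Lambda_def elem_cubes_def)
  then have "real_of_int \<bar>fst (Q ! i)\<bar> \<le> real_of_int (int n)" if "i < d" for i
    using that by simp
  then have "\<bar>fst (Q ! i)\<bar> \<le> int n" if "i < d" for i
    using that unfolding of_int_le_iff by blast
  then show ?thesis using assms by (simp add: cubes_box_def)
qed

lemma finite_cubes_in_Xn: "finite (cubes_in d (Xn d \<omega> n t) k)"
  by (rule finite_subset[OF _ finite_cubes_box[of d n]])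
    (auto simp: cubes_in_def Xn_def intro: cubes_in_Lambda)

definition level_cubes :: "nat \<Rightarrow> nat \<Rightarrow> real \<Rightarrow> real \<Rightarrow> (ecube \<Rightarrow> real) \<Rightarrow> ecube set" where
  "level_cubes d n s t \<omega> = {R \<in> cubes_box d n. s < \<omega> R \<and> \<omega> R \<le> t}"

text \<open>A new cube \<open>Q\<close> lies in a single generating cube \<open>R\<close> with
  \<open>\<omega> R \<le> t\<close>, found through the midpoint of \<open>Q\<close>;
  \<open>\<omega> R \<le> s\<close> would put \<open>Q\<close> into the earlier set. Each such
  \<open>R\<close> accounts for at most \<open>3 ^ d\<close> cubes \<open>Q\<close>.\<close>

lemma card_new_cubes_le:
  "card (cubes_in d (Xn d \<omega> n t) k - cubes_in d (Xn d \<omega> n s) k)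
     \<le> 3 ^ d * card (level_cubes d (Suc n) s t \<omega>)"
proof -
  let ?D = "cubes_in d (Xn d \<omega> n t) k - cubes_in d (Xn d \<omega> n s) k"
  let ?L = "level_cubes d (Suc n) s t \<omega>"
  have finL: "finite ?L" unfolding level_cubes_def using finite_cubes_box by simp
  have lenL: "length R = d" if "R \<in> ?L" for R
    using that by (simp add: level_cubes_def cubes_box_def elem_cubes_def)
  have "?D \<subseteq> (\<Union>R\<in>?L. faces R)"
  proof
    fix Q assume "Q \<in> ?D"
    then have Q: "length Q = d" "cube_set Q \<subseteq> Xt d \<omega> t" "cube_set Q \<subseteq> Lambda d n"
      and nQ: "\<not> cube_set Q \<subseteq> Xt d \<omega> s"
      by (auto simp: cubes_in_def Xn_def elem_cubes_def)
    have Qb: "Q \<in> cubes_box d n" using Q by (intro cubes_in_Lambda) (auto simp: elem_cubes_def)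
    let ?m = "map (\<lambda>I. real_of_int (fst I) + (if snd I then 1/2 else 0)) Q"
    have "?m \<in> cube_set Q" by (auto simp: cube_set_def eint_set_def)
    then obtain R where R: "R \<in> elem_cubes d" "\<omega> R \<le> t" "?m \<in> cube_set R"
      using Q(2) unfolding Xt_def by blast
    have len: "length R = length Q" using R(1) Q(1) by (simp add: elem_cubes_def)
    note sub = cube_set_subset_of_midpoint[OF len R(3)]
    have "s < \<omega> R"
    proof (rule ccontr)
      assume "\<not> s < \<omega> R"
      then have "cube_set R \<subseteq> Xt d \<omega> s" using R(1) unfolding Xt_def by force
      then show False using sub(2) nQ by blast
    qed
    \<comment> \<open>The radius grows by one because \<open>Q\<close> may be a right-hand face of
      \<open>R\<close>, which puts the left endpoint of \<open>R\<close> as low as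
      \<open>- n - 1\<close>.\<close>
    moreover have "R \<in> cubes_box d (Suc n)"
      unfolding cubes_box_def
    proof (intro CollectI conjI R(1) allI impI)
      fix i assume i: "i < d"
      then have "\<bar>fst (Q ! i)\<bar> \<le> int n" using Qb by (simp add: cubes_box_def)
      moreover have "fst (Q ! i) = fst (R ! i) \<or> fst (Q ! i) = fst (R ! i) + 1"
        using list_all2_nthD[OF sub(1), of i] i len Q(1) by auto
      ultimately show "\<bar>fst (R ! i)\<bar> \<le> int (Suc n)" by auto
    qed
    ultimately have "R \<in> ?L" using R(2) by (simp add: level_cubes_def)
    moreover have "Q \<in> faces R" using sub(1) by (simp add: faces_def)
    ultimately show "Q \<in> (\<Union>R\<in>?L. faces R)" by blast
  qed
  then have "card ?D \<le> card (\<Union>R\<in>?L. faces R)"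
    using finL finite_faces by (intro card_mono) auto
  also have "\<dots> \<le> (\<Sum>R\<in>?L. card (faces R))" using finL by (rule card_UN_le)
  also have "\<dots> \<le> (\<Sum>R\<in>?L. 3 ^ d)" using card_faces_le lenL by (intro sum_mono) metis
  finally show ?thesis by (simp add: mult.commute)
qed

lemma betti_n_diff_le:
  assumes "s \<le> t"
  shows "\<bar>betti_n d q \<omega> n t - betti_n d q \<omega> n s\<bar> \<le> 3 ^ d * real (card (level_cubes d (Suc n) s t \<omega>))"
proof -
  have "Xn d \<omega> n s \<subseteq> Xn d \<omega> n t" using assms unfolding Xn_def Xt_def by fastforce
  from betti_diff_le[OF finite_cubes_in_Xn finite_cubes_in_Xn this card_new_cubes_le card_new_cubes_le]
  show ?thesis unfolding betti_n_def by simp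
qed

text \<open>Representatives of the elementary cubes modulo lattice translations.\<close>
definition corner_cubes :: "nat \<Rightarrow> ecube set" where
  "corner_cubes d = {R. set R \<subseteq> {0} \<times> UNIV \<and> length R = d}"

lemma finite_corner_cubes: "finite (corner_cubes d)"
  unfolding corner_cubes_def by (intro finite_lists_length_eq) auto

lemma length_shift_cube [simp]: "length (shift_cube x Q) = min (length Q) (length x)"
  by (simp add: shift_cube_def)

lemma nth_shift_cube:
  "i < length Q \<Longrightarrow> i < length x \<Longrightarrow> shift_cube x Q ! i = (fst (Q ! i) + x ! i, snd (Q ! i))"
  by (simp add: shift_cube_def)

definition level_count :: "nat \<Rightarrow> real \<Rightarrow> real \<Rightarrow> (ecube \<Rightarrow> real) \<Rightarrow> real" where
  "level_count d s t \<omega> = (\<Sum>R\<in>corner_cubes d. indicator {s<..t} (\<omega> R))"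

text \<open>Every cube is the translate of a corner cube by its vector of left endpoints. Since
  \<open>tau d x\<close> reads \<open>\<omega>\<close> at cubes shifted by \<open>- x\<close>, the
  count at position \<open>x\<close> is \<open>level_count\<close> evaluated at \<open>tau\<close>
  of \<open>- x\<close>.\<close>

lemma card_level_cubes_le:
  "real (card (level_cubes d n s t \<omega>))
     \<le> (\<Sum>x\<in>lattice_box (origin d) n. level_count d s t (tau d (map uminus x) \<omega>))"
proof -
  let ?S = "lattice_box (origin d) n \<times> corner_cubes d"
  let ?h = "\<lambda>(x, R). shift_cube x R"
  let ?S' = "{p \<in> ?S. \<omega> (?h p) \<in> {s<..t}}"
  have finS: "finite ?S" using finite_corner_cubes by simp
  have "level_cubes d n s t \<omega> \<subseteq> ?h ` ?S'"
  proof
    fix R assume R: "R \<in> level_cubes d n s t \<omega>"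
    then have len: "length R = d" by (simp add: level_cubes_def cubes_box_def elem_cubes_def)
    let ?p = "(map fst R, map (\<lambda>I. (0 :: int, snd I)) R)"
    have h: "?h ?p = R" by (auto simp: list_eq_iff_nth_eq nth_shift_cube)
    have "?p \<in> ?S"
      using R len by (auto simp: lattice_box_iff corner_cubes_def level_cubes_def cubes_box_def)
    then have "?p \<in> ?S'" using R h by (simp add: level_cubes_def)
    then show "R \<in> ?h ` ?S'" using h by (metis (no_types, lifting) image_eqI)
  qed
  then have "card (level_cubes d n s t \<omega>) \<le> card (?h ` ?S')"
    using finS by (intro card_mono) auto
  also have "\<dots> \<le> card ?S'" using finS by (intro card_image_le) auto
  finally have "real (card (level_cubes d n s t \<omega>)) \<le> real (card ?S')" by simp
  also have "\<dots> = (\<Sum>p\<in>?S. indicator {s<..t} (\<omega> (?h p)))"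
    using finS by (simp add: indicator_def sum.If_cases Int_def)
  also have "\<dots> = (\<Sum>x\<in>lattice_box (origin d) n. \<Sum>R\<in>corner_cubes d. indicator {s<..t} (\<omega> (shift_cube x R)))"
    by (subst sum.cartesian_product) (simp add: case_prod_beta)
  also have "\<dots> = (\<Sum>x\<in>lattice_box (origin d) n. level_count d s t (tau d (map uminus x) \<omega>))"
    unfolding level_count_def
    by (intro sum.cong refl) (auto simp: tau_def elem_cubes_def corner_cubes_def o_def)
  finally show ?thesis .
qed

section \<open>Uniform convergence\<close>

lemma shift_cube_shift_cube:
  assumes "length x = length Q" "length y = length Q"
  shows "shift_cube x (shift_cube y Q) = shift_cube (ladd x y) Q"
  using assms by (auto simp: list_eq_iff_nth_eq nth_shift_cube)

lemma map_uminus_uminus [simp]: "map uminus (map uminus x) = (x :: int list)"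
  by (simp add: o_def)

lemma tau_uminus:
  "tau d (map uminus x) \<omega> = (\<lambda>Q. if Q \<in> elem_cubes d then \<omega> (shift_cube x Q) else undefined)"
  unfolding tau_def map_uminus_uminus ..

text \<open>The sign is chosen so that the action by \<open>x\<close> reads \<open>\<omega>\<close>
  at cubes shifted by \<open>+ x\<close>; its orbit sums are then those in
  \<open>card_level_cubes_le\<close>.\<close>

lemma lattice_action_tau:
  assumes "prob_space P" and sets: "sets P = sets (Omega d)"
    and stat: "stationary d P" and erg: "ergodic d P"
  shows "lattice_action P d (\<lambda>x. tau d (map uminus x))"
proof -
  interpret prob_space P by fact
  have elem: "shift_cube x Q \<in> elem_cubes d" if "length x = d" "Q \<in> elem_cubes d" for x Q
    using that by (simp add: elem_cubes_def)
  have meas: "tau d (map uminus x) \<in> measurable P P" if x: "length x = d" for x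
  proof -
    have "(\<lambda>\<omega> Q. if Q \<in> elem_cubes d then \<omega> (shift_cube x Q) else undefined)
        \<in> measurable (Omega d) (Omega d)"
      unfolding Omega_def
    proof (rule measurable_PiM_single')
      fix Q assume Q: "Q \<in> elem_cubes d"
      then show "(\<lambda>\<omega>. if Q \<in> elem_cubes d then \<omega> (shift_cube x Q) else undefined)
        \<in> measurable (Pi\<^sub>M (elem_cubes d) (\<lambda>_. restrict_space borel {0..1})) (restrict_space borel {0..1})"
        using measurable_component_singleton[OF elem[OF x Q]] by simp
    next
      show "(\<lambda>\<omega> Q. if Q \<in> elem_cubes d then \<omega> (shift_cube x Q) else undefined)
        \<in> space (Pi\<^sub>M (elem_cubes d) (\<lambda>_. restrict_space borel {0..1}))
          \<rightarrow> (\<Pi>\<^sub>E i\<in>elem_cubes d. space (restrict_space borel {0..1::real}))"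
        using elem[OF x] by (auto simp: space_PiM PiE_iff extensional_def)
    qed
    then show ?thesis
      using measurable_cong_sets[OF sets sets] unfolding tau_uminus by auto
  qed
  show ?thesis
  proof
    fix x :: "int list" assume x: "length x = d"
    show "tau d (map uminus x) \<in> measurable P P" using x by (rule meas)
    show "distr P P (tau d (map uminus x)) = P"
    proof (rule measure_eqI)
      fix A assume "A \<in> sets (distr P P (tau d (map uminus x)))"
      then show "emeasure (distr P P (tau d (map uminus x))) A = emeasure P A"
        using stat x meas[OF x] by (simp add: emeasure_distr stationary_def)
    qed simp
  next
    fix x y :: "int list" and \<omega> assume "length x = d" "length y = d"
    then show "tau d (map uminus y) (tau d (map uminus x) \<omega>) = tau d (map uminus (ladd x y)) \<omega>"
      unfolding tau_uminus using elem
      by (auto simp: fun_eq_iff shift_cube_shift_cube elem_cubes_def)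
  next
    fix A assume A: "A \<in> sets P" "\<And>x. length x = d \<Longrightarrow> tau d (map uminus x) -` A \<inter> space P = A"
    \<comment> \<open>Negation permutes the translation vectors, so both sign conventions have the
      same invariant events.\<close>
    have "tau d x -` A \<inter> space P = A" if "length x = d" for x
      using A(2)[of "map uminus x"] that by (simp only: map_uminus_uminus length_map)
    then show "prob A = 0 \<or> prob A = 1" using erg A(1) unfolding ergodic_def by blast
  qed
qed

section \<open>Expected numbers of entering cubes\<close>

lemma component_measurable:
  assumes "sets P = sets (Omega d)" "Q \<in> elem_cubes d"
  shows "(\<lambda>\<omega>. \<omega> Q) \<in> borel_measurable P"
proof -
  have "(\<lambda>\<omega>. \<omega> Q) \<in> measurable (Omega d) (restrict_space borel {0..1::real})"
    unfolding Omega_def using assms(2) by (rule measurable_component_singleton)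
  then have "(\<lambda>\<omega>. \<omega> Q) \<in> borel_measurable (Omega d)"
    by (simp add: measurable_restrict_space2_iff)
  then show ?thesis using measurable_cong_sets[OF assms(1) refl] by blast
qed

lemma corner_cubes_elem: "R \<in> corner_cubes d \<Longrightarrow> R \<in> elem_cubes d"
  by (simp add: corner_cubes_def elem_cubes_def)

text \<open>The expectation is an increment of a finite sum of marginal distribution functions;
  continuity of the marginals enters through this formula.\<close>

lemma level_count_integral:
  assumes "prob_space P" and sets: "sets P = sets (Omega d)" and "s \<le> t"
  shows "integrable P (level_count d s t)"
    and "(\<integral>\<omega>. level_count d s t \<omega> \<partial>P) = (\<Sum>R\<in>corner_cubes d. measure P {\<omega>\<in>space P. \<omega> R \<le> t})
           - (\<Sum>R\<in>corner_cubes d. measure P {\<omega>\<in>space P. \<omega> R \<le> s})"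
proof -
  interpret prob_space P by fact
  have one: "has_bochner_integral P (\<lambda>\<omega>. indicator {s<..t} (\<omega> R) :: real)
     (measure P {\<omega>\<in>space P. \<omega> R \<le> t} - measure P {\<omega>\<in>space P. \<omega> R \<le> s})" if R: "R \<in> corner_cubes d" for R
  proof -
    have [measurable]: "(\<lambda>\<omega>. \<omega> R) \<in> borel_measurable P"
      using component_measurable[OF sets corner_cubes_elem[OF R]] .
    let ?A = "{\<omega>\<in>space P. \<omega> R \<le> t} - {\<omega>\<in>space P. \<omega> R \<le> s}"
    have "has_bochner_integral P (indicator ?A :: _ \<Rightarrow> real) (measure P ?A)"
      by (rule has_bochner_integral_real_indicator) (auto simp: emeasure_eq_measure)
    moreover have "measure P ?A = measure P {\<omega>\<in>space P. \<omega> R \<le> t} - measure P {\<omega>\<in>space P. \<omega> R \<le> s}"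
      using \<open>s \<le> t\<close> by (intro finite_measure_Diff) auto
    moreover have "has_bochner_integral P (\<lambda>\<omega>. indicator {s<..t} (\<omega> R) :: real) v
        \<longleftrightarrow> has_bochner_integral P (indicator ?A :: _ \<Rightarrow> real) v" for v
      by (rule has_bochner_integral_cong) (auto simp: indicator_def)
    ultimately show ?thesis by simp
  qed
  have "has_bochner_integral P (level_count d s t) (\<Sum>R\<in>corner_cubes d.
      measure P {\<omega>\<in>space P. \<omega> R \<le> t} - measure P {\<omega>\<in>space P. \<omega> R \<le> s})"
    unfolding level_count_def[abs_def] using one by (rule has_bochner_integral_sum)
  then show "integrable P (level_count d s t)"
    "(\<integral>\<omega>. level_count d s t \<omega> \<partial>P) = (\<Sum>R\<in>corner_cubes d. measure P {\<omega>\<in>space P. \<omega> R \<le> t})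
           - (\<Sum>R\<in>corner_cubes d. measure P {\<omega>\<in>space P. \<omega> R \<le> s})"
    by (auto simp: has_bochner_integral_iff sum_subtractf)
qed

text \<open>The count of cubes entering between \<open>s\<close> and \<open>u\<close> controls all
  intermediate levels at once, so one null set serves every \<open>t\<close> in the
  interval.\<close>

lemma AE_betti_n_oscillation:
  assumes "prob_space P" and sets: "sets P = sets (Omega d)"
    and "stationary d P" and "ergodic d P" and "s \<le> u"
    and small: "(\<integral>\<omega>. level_count d s u \<omega> \<partial>P) < e"
  shows "AE \<omega> in P. \<forall>\<^sub>F n in sequentially. \<forall>t\<in>{s..u}.
    \<bar>betti_n d q \<omega> n t / vol_Lambda d n - betti_n d q \<omega> n s / vol_Lambda d n\<bar> \<le> 18 ^ d * e"
proof -
  interpret lattice_action P d "\<lambda>x. tau d (map uminus x)"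
    using assms by (intro lattice_action_tau)
  have nonneg: "level_count d s u \<omega> \<ge> 0" for \<omega> by (simp add: level_count_def sum_nonneg)
  have "2 ^ d * (\<integral>\<omega>. level_count d s u \<omega> \<partial>P) < 2 ^ d * e" using small by simp
  from AE_eventually_sum_orbit_le[OF level_count_integral(1)[OF assms(1,2,5)] nonneg this]
  show ?thesis
  proof (rule AE_mp, intro AE_I2 impI)
    fix \<omega> assume ev: "\<forall>\<^sub>F n in sequentially. (\<Sum>y\<in>lattice_box (origin d) n. level_count d s u (tau d (map uminus y) \<omega>))
      \<le> 2 ^ d * e * (2 * real n + 1) ^ d"
    have "\<forall>\<^sub>F n in sequentially. (\<Sum>y\<in>lattice_box (origin d) (Suc n). level_count d s u (tau d (map uminus y) \<omega>))
      \<le> 2 ^ d * e * (2 * real (Suc n) + 1) ^ d"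
      using ev by (subst eventually_sequentially_Suc)
    then show "\<forall>\<^sub>F n in sequentially. \<forall>t\<in>{s..u}.
      \<bar>betti_n d q \<omega> n t / vol_Lambda d n - betti_n d q \<omega> n s / vol_Lambda d n\<bar> \<le> 18 ^ d * e"
      using eventually_ge_at_top[of 1]
    proof (eventually_elim, intro ballI)
      fix n t assume n: "n \<ge> (1::nat)" and t: "t \<in> {s..u}"
        and le: "(\<Sum>y\<in>lattice_box (origin d) (Suc n). level_count d s u (tau d (map uminus y) \<omega>))
          \<le> 2 ^ d * e * (2 * real (Suc n) + 1) ^ d"
      have vol: "vol_Lambda d n > 0" using n by (simp add: vol_Lambda_def)
      have "0 \<le> (\<integral>\<omega>. level_count d s u \<omega> \<partial>P)" using nonneg by simp
      with small have e: "e > 0" by linarith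
      have "\<bar>betti_n d q \<omega> n t - betti_n d q \<omega> n s\<bar> \<le> 3 ^ d * real (card (level_cubes d (Suc n) s t \<omega>))"
        using t by (intro betti_n_diff_le) simp
      \<comment> \<open>Passing from \<open>t\<close> to \<open>u\<close> makes the bound uniform in
        \<open>t\<close>.\<close>
      also have "card (level_cubes d (Suc n) s t \<omega>) \<le> card (level_cubes d (Suc n) s u \<omega>)"
        using t finite_cubes_box by (intro card_mono) (auto simp: level_cubes_def)
      also have "real (card (level_cubes d (Suc n) s u \<omega>)) \<le> 2 ^ d * e * (2 * real (Suc n) + 1) ^ d"
        using card_level_cubes_le le by (rule order_trans)
      also have "\<dots> \<le> 2 ^ d * e * (3 * (2 * real n)) ^ d"
        using n e by (intro mult_left_mono power_mono) auto
      \<comment> \<open>The factors of 18: 3 from the faces of a cube, 2 from the maximal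
        inequality, and 3 from \<open>2 * Suc n + 1 \<le> 3 * (2 * n)\<close> for
        \<open>n \<ge> 1\<close>, which absorbs the enlarged window.\<close>
      also have "3 ^ d * (2 ^ d * e * (3 * (2 * real n)) ^ d) = (3 * (2 * 3)) ^ d * e * vol_Lambda d n"
        unfolding vol_Lambda_def power_mult_distrib by (simp add: algebra_simps)
      finally have "\<bar>betti_n d q \<omega> n t - betti_n d q \<omega> n s\<bar> \<le> 18 ^ d * e * vol_Lambda d n" by simp
      then show "\<bar>betti_n d q \<omega> n t / vol_Lambda d n - betti_n d q \<omega> n s / vol_Lambda d n\<bar> \<le> 18 ^ d * e"
        using vol by (simp add: diff_divide_distrib[symmetric] divide_le_eq)
    qed
  qed
qed

text \<open>Three errors of size at most \<open>18 ^ d * e\<close> add up: oscillation of the Betti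
  averages on a partition interval, convergence at its left endpoint, and oscillation of
  \<open>bhat\<close> on the interval.\<close>

lemma AE_eventually_uniformly_close:
  assumes "prob_space P"
    and "sets P = sets (Omega d)"
    and "stationary d P" and "ergodic d P"
    and lim: "\<forall>t\<in>{0..1}. AE \<omega> in P. (\<lambda>n. betti_n d q \<omega> n t / vol_Lambda d n) \<longlonglongrightarrow> bhat t"
    and cont: "\<forall>Q\<in>elem_cubes d. continuous_on {0..1} (\<lambda>t. measure P {\<omega>\<in>space P. \<omega> Q \<le> t})"
    and e: "e > 0"
  shows "AE \<omega> in P. \<forall>\<^sub>F n in sequentially. \<forall>t\<in>{0..1}.
    \<bar>betti_n d q \<omega> n t / vol_Lambda d n - bhat t\<bar> \<le> 3 * (18 ^ d * e)"
proof -
  interpret prob_space P by fact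
  define b where "b \<omega> n t = betti_n d q \<omega> n t / vol_Lambda d n" for \<omega> n t
  define c where "c = 18 ^ d * e"
  have c: "c > 0" using e by (simp add: c_def)
  \<comment> \<open>Increments of \<open>G\<close> are the expectations of
    \<open>level_count\<close>, so uniform continuity yields one mesh for which all of them are
    below \<open>e\<close>.\<close>
  define G where "G t = (\<Sum>R\<in>corner_cubes d. measure P {\<omega>\<in>space P. \<omega> R \<le> t})" for t
  have "continuous_on {0..1} G"
    unfolding G_def using cont corner_cubes_elem by (intro continuous_on_sum) blast
  then have "uniformly_continuous_on {0..1} G"
    using compact_uniformly_continuous compact_Icc by blast
  then obtain \<delta> where \<delta>: "\<delta> > 0"
    "\<And>s t. s \<in> {0..1} \<Longrightarrow> t \<in> {0..1} \<Longrightarrow> dist t s < \<delta> \<Longrightarrow> dist (G t) (G s) < e"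
    using e unfolding uniformly_continuous_on_def by meson
  obtain m where m: "1 / real (Suc m) < \<delta>" using nat_approx_posE[OF \<delta>(1)] by auto
  define M where "M = Suc m"
  define s where "s i = real i / real M" for i
  have M: "M > 0" "1 / real M < \<delta>" using m by (auto simp: M_def)
  have s01: "s i \<in> {0..1}" if "i \<le> M" for i using that M by (auto simp: s_def)
  have s_Suc: "s (Suc i) = s i + 1 / real M" for i by (simp add: s_def add_divide_distrib)
  have osc: "AE \<omega> in P. \<forall>\<^sub>F n in sequentially. \<forall>t\<in>{s i..s (Suc i)}. \<bar>b \<omega> n t - b \<omega> n (s i)\<bar> \<le> c"
    if i: "i < M" for i
    unfolding b_def c_def
  proof (rule AE_betti_n_oscillation[OF assms(1-4)])
    show le: "s i \<le> s (Suc i)" by (simp add: s_Suc)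
    have "dist (s (Suc i)) (s i) < \<delta>" using M by (simp add: s_Suc dist_real_def)
    then have "dist (G (s (Suc i))) (G (s i)) < e" using i by (intro \<delta>(2) s01) auto
    then show "(\<integral>\<omega>. level_count d (s i) (s (Suc i)) \<omega> \<partial>P) < e"
      unfolding level_count_integral(2)[OF assms(1,2) le] G_def dist_real_def by linarith
  qed
  have lim_b: "AE \<omega> in P. (\<lambda>n. b \<omega> n t) \<longlonglongrightarrow> bhat t" if "t \<in> {0..1}" for t
    using lim that unfolding b_def by blast
  have bhat: "\<bar>bhat t - bhat (s i)\<bar> \<le> c" if i: "i < M" and t: "t \<in> {s i..s (Suc i)}" for i t
  proof -
    have t01: "t \<in> {0..1}" using s01[of i] s01[of "Suc i"] i t by auto
    have "s i \<in> {0..1}" using s01 i by simp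
    from osc[OF i] lim_b[OF t01] lim_b[OF this]
    have "AE \<omega> in P. \<bar>bhat t - bhat (s i)\<bar> \<le> c"
    proof eventually_elim
      fix \<omega> assume ev: "\<forall>\<^sub>F n in sequentially. \<forall>t\<in>{s i..s (Suc i)}. \<bar>b \<omega> n t - b \<omega> n (s i)\<bar> \<le> c"
        and "(\<lambda>n. b \<omega> n t) \<longlonglongrightarrow> bhat t" "(\<lambda>n. b \<omega> n (s i)) \<longlonglongrightarrow> bhat (s i)"
      then have "(\<lambda>n. \<bar>b \<omega> n t - b \<omega> n (s i)\<bar>) \<longlonglongrightarrow> \<bar>bhat t - bhat (s i)\<bar>"
        by (intro tendsto_intros)
      moreover have "\<forall>\<^sub>F n in sequentially. \<bar>b \<omega> n t - b \<omega> n (s i)\<bar> \<le> c"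
        using ev by eventually_elim (use t in blast)
      ultimately show "\<bar>bhat t - bhat (s i)\<bar> \<le> c"
        by (rule tendsto_upperbound) simp
    qed
    \<comment> \<open>The bound does not involve \<open>\<omega>\<close>, so holding almost surely
      under a probability measure means holding outright.\<close>
    then show ?thesis by simp
  qed
  have "AE \<omega> in P. \<forall>i\<in>{..<M}. \<forall>\<^sub>F n in sequentially. \<forall>t\<in>{s i..s (Suc i)}. \<bar>b \<omega> n t - b \<omega> n (s i)\<bar> \<le> c"
    by (rule AE_finite_allI) (use osc in auto)
  moreover have "AE \<omega> in P. \<forall>i\<in>{..<M}. (\<lambda>n. b \<omega> n (s i)) \<longlonglongrightarrow> bhat (s i)"
    by (rule AE_finite_allI) (use lim_b s01 in auto)
  ultimately have "AE \<omega> in P. \<forall>\<^sub>F n in sequentially. \<forall>t\<in>{0..1}. \<bar>b \<omega> n t - bhat t\<bar> \<le> 3 * c"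
  proof (elim AE_mp, intro AE_I2 impI)
    fix \<omega> assume
      o: "\<forall>i\<in>{..<M}. \<forall>\<^sub>F n in sequentially. \<forall>t\<in>{s i..s (Suc i)}. \<bar>b \<omega> n t - b \<omega> n (s i)\<bar> \<le> c" and
      l: "\<forall>i\<in>{..<M}. (\<lambda>n. b \<omega> n (s i)) \<longlonglongrightarrow> bhat (s i)"
    have "\<forall>\<^sub>F n in sequentially. \<forall>i\<in>{..<M}. \<forall>t\<in>{s i..s (Suc i)}. \<bar>b \<omega> n t - b \<omega> n (s i)\<bar> \<le> c"
      using o by (intro eventually_ball_finite) auto
    moreover have "\<forall>\<^sub>F n in sequentially. \<forall>i\<in>{..<M}. \<bar>b \<omega> n (s i) - bhat (s i)\<bar> < c"
      using l c by (intro eventually_ball_finite) (auto simp: tendsto_iff dist_real_def)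
    ultimately show "\<forall>\<^sub>F n in sequentially. \<forall>t\<in>{0..1}. \<bar>b \<omega> n t - bhat t\<bar> \<le> 3 * c"
    proof (eventually_elim, intro ballI)
      fix n t assume
        o: "\<forall>i\<in>{..<M}. \<forall>t\<in>{s i..s (Suc i)}. \<bar>b \<omega> n t - b \<omega> n (s i)\<bar> \<le> c" and
        l: "\<forall>i\<in>{..<M}. \<bar>b \<omega> n (s i) - bhat (s i)\<bar> < c" and t: "t \<in> {0..1::real}"
      \<comment> \<open>The point \<open>t = 1\<close> is assigned to the last interval, of index
        \<open>m\<close>; the floor would give the index \<open>M\<close>, which is out of
        range.\<close>
      obtain i where i: "i < M" "t \<in> {s i..s (Suc i)}"
      proof (cases "t = 1")
        case True
        then show thesis using that[of m] by (simp add: s_def M_def)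
      next
        case False
        define i where "i = nat \<lfloor>t * real M\<rfloor>"
        have tM: "0 \<le> t * real M" using t by simp
        have fl: "real i \<le> t * real M" "t * real M < real i + 1"
          unfolding i_def using tM by (simp_all add: of_nat_nat)
        have "t * real M < real M" using t False M by simp
        then have "i < M" using fl by linarith
        moreover have "t \<in> {s i..s (Suc i)}"
          using fl M by (auto simp: s_def field_simps)
        ultimately show thesis by (rule that)
      qed
      have "\<bar>b \<omega> n t - b \<omega> n (s i)\<bar> \<le> c" "\<bar>b \<omega> n (s i) - bhat (s i)\<bar> < c"
        using o l i by blast+
      then show "\<bar>b \<omega> n t - bhat t\<bar> \<le> 3 * c" using bhat[OF i] by linarith
    qed
  qed
  then show ?thesis unfolding b_def c_def .
qed

theorem theorem2p9:
  fixes d q :: nat and P :: "(ecube \<Rightarrow> real) measure" and bhat :: "real \<Rightarrow> real"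
  assumes "prob_space P"
    and "sets P = sets (Omega d)"
    and "stationary d P" and "ergodic d P"
    and "q < d"
    and "\<forall>t\<in>{0..1}. AE \<omega> in P.
           (\<lambda>n. betti_n d q \<omega> n t / vol_Lambda d n) \<longlonglongrightarrow> bhat t"
    and "\<forall>Q\<in>elem_cubes d. continuous_on {0..1} (\<lambda>t. measure P {\<omega>\<in>space P. \<omega> Q \<le> t})"
  shows "AE \<omega> in P. (\<lambda>n. SUP t\<in>{0..1}. \<bar>betti_n d q \<omega> n t / vol_Lambda d n - bhat t\<bar>)
           \<longlonglongrightarrow> 0"
proof -
  \<comment> \<open>Restricting the tolerance to the values \<open>1 / Suc j\<close> leaves
    countably many null sets, whose union is null.\<close>
  have "AE \<omega> in P. \<forall>j. \<forall>\<^sub>F n in sequentially. \<forall>t\<in>{0..1}.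
    \<bar>betti_n d q \<omega> n t / vol_Lambda d n - bhat t\<bar> \<le> 3 * (18 ^ d * (1 / real (Suc j)))"
    unfolding AE_all_countable
    by (intro allI AE_eventually_uniformly_close[OF assms(1-4,6,7)]) simp
  then show ?thesis
  proof (rule AE_mp, intro AE_I2 impI)
    fix \<omega>
    let ?D = "\<lambda>n t. \<bar>betti_n d q \<omega> n t / vol_Lambda d n - bhat t\<bar>"
    assume ev: "\<forall>j. \<forall>\<^sub>F n in sequentially. \<forall>t\<in>{0..1}. ?D n t \<le> 3 * (18 ^ d * (1 / real (Suc j)))"
    show "(\<lambda>n. SUP t\<in>{0..1}. ?D n t) \<longlonglongrightarrow> 0"
    proof (rule tendstoI)
      fix e :: real assume e: "e > 0"
      then have "e / (3 * 18 ^ d) > 0" by simp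
      then obtain j where "1 / real (Suc j) < e / (3 * 18 ^ d)"
        using nat_approx_posE by blast
      then have j: "3 * (18 ^ d * (1 / real (Suc j))) < e" by (simp add: field_simps)
      from ev have "\<forall>\<^sub>F n in sequentially. \<forall>t\<in>{0..1}. ?D n t \<le> 3 * (18 ^ d * (1 / real (Suc j)))" ..
      then show "\<forall>\<^sub>F n in sequentially. dist (SUP t\<in>{0..1}. ?D n t) 0 < e"
      proof eventually_elim
        fix n assume le: "\<forall>t\<in>{0..1}. ?D n t \<le> 3 * (18 ^ d * (1 / real (Suc j)))"
        have "(SUP t\<in>{0..1}. ?D n t) \<le> 3 * (18 ^ d * (1 / real (Suc j)))"
          using le by (intro cSUP_least) auto
        \<comment> \<open>Boundedness makes the real supremum an upper bound of the value at
          \<open>t = 0\<close>; hence it is nonnegative and equals its distance to 0.\<close>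
        moreover have "bdd_above (?D n ` {0..1})" using le by (auto intro: bdd_aboveI2)
        then have "?D n 0 \<le> (SUP t\<in>{0..1}. ?D n t)" by (intro cSUP_upper) auto
        then have "0 \<le> (SUP t\<in>{0..1}. ?D n t)" by linarith
        ultimately show "dist (SUP t\<in>{0..1}. ?D n t) 0 < e" using j by (simp add: dist_real_def)
      qed
    qed
  qed
qed

end
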